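(* Let $X$ be a proper geodesic metric space. Then $\partial_c^{\mathcal{FQ}}X$ is first countable.
   Context: A function $\rho\colon[0,\infty)\to\mathbb{R}$ is sublinear if it is non-decreasing, eventually non-negative, and $\lim_{r\to\infty}\rho(r)/r=0$. Let $X$ be a proper geodesic metric space with metric $d$. For a closed subset $Z\subset X$ let $\pi_Z(x):=\{z\in Z\mid d(x,z)=d(x,Z)\}$. For sublinear $\rho$, $Z$ is $\rho$-contracting if for all $x,y\in X$: $d(x,y)\le d(x,Z)$ implies $\operatorname{diam}(\pi_Z(x)\cup\pi_Z(y))\le\rho(d(x,Z))$. $Z$ is contracting if it is $\rho$-contracting for some sublinear $\rho$. A geodesic is an isometric embedding of an interval. For $L\ge1$, $A\ge0$, an $(L,A)$-quasi-geodesic is a map $\gamma$ from an interval with $\frac1L|s-t|-A\le d(\gamma(s),\gamma(t))\le L|s-t|+A$ for all $s,t$; a ray has domain $[0,\infty)$. Quasi-geodesics are conflated with their images, and a quasi-geodesic is contracting if its image is. Fix a basepoint $o\in X$. $\partial_cX$ is the set of contracting quasi-geodesic rays based at $o$ modulo finite Hausdorff distance. Every $\zeta\in\partial_cX$ contains a geodesic ray based at $o$; the function $\rho_\zeta(r):=\sup\operatorname{diam}(\pi_\alpha(x)\cup\pi_\alpha(y))$, with supremum over geodesic rays $\alpha\in\zeta$ (based at $o$) and points $x,y$ with $d(x,y)\le d(x,\alpha)\le r$, is sublinear and every geodesic in $\zeta$ is $\rho_\zeta$-contracting. For each $\zeta$ fix a geodesic ray $\alpha^\zeta\in\zeta$.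 For sublinear $\rho$, $L\ge1$, $A\ge0$ set $\kappa(\rho,L,A):=\max\{3A,\,3L^2,\,1+\inf\{R>0\mid\forall r\ge R,\ 3L^2\rho(r)\le r\}\}$. For $r\ge1$, $U(\zeta,r)$ is the set of $\eta\in\partial_cX$ such that for all $L\ge1$, $A\ge0$ and every continuous $(L,A)$-quasi-geodesic ray $\beta\in\eta$ (based at $o$) we have $d(\beta,\{x\in\alpha^\zeta\mid d(x,o)\ge r\})\le\kappa(\rho_\zeta,L,A)$. The topology of fellow-travelling quasi-geodesics is $\mathcal{FQ}:=\{U\subset\partial_cX\mid\forall\zeta\in U\ \exists r\ge1,\ U(\zeta,r)\subset U\}$, and $\partial_c^{\mathcal{FQ}}X$ is $\partial_cX$ with this topology. *)

theory Defs
  imports "HOL-Analysis.Analysis"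
begin

text \<open>The space \<open>X\<close> is the universe of a type \<open>'a\<close> of class \<open>metric_space\<close>.\<close>

definition proper_space :: "'a::metric_space itself \<Rightarrow> bool" where
  "proper_space _ \<longleftrightarrow> (\<forall>(x::'a) r. compact (cball x r))"

definition geodesic_on :: "real set \<Rightarrow> (real \<Rightarrow> 'a::metric_space) \<Rightarrow> bool" where
  "geodesic_on I \<gamma> \<longleftrightarrow> is_interval I \<and> (\<forall>s\<in>I. \<forall>t\<in>I. dist (\<gamma> s) (\<gamma> t) = \<bar>s - t\<bar>)"

definition geodesic_space :: "'a::metric_space itself \<Rightarrow> bool" where
  "geodesic_space _ \<longleftrightarrow>
     (\<forall>x y::'a. \<exists>\<gamma>. geodesic_on {0..dist x y} \<gamma> \<and> \<gamma> 0 = x \<and> \<gamma> (dist x y) = y)"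

definition quasi_geodesic_on ::
    "real \<Rightarrow> real \<Rightarrow> real set \<Rightarrow> (real \<Rightarrow> 'a::metric_space) \<Rightarrow> bool" where
  "quasi_geodesic_on L A I \<gamma> \<longleftrightarrow> is_interval I \<and>
     (\<forall>s\<in>I. \<forall>t\<in>I. (1 / L) * \<bar>s - t\<bar> - A \<le> dist (\<gamma> s) (\<gamma> t) \<and>
                   dist (\<gamma> s) (\<gamma> t) \<le> L * \<bar>s - t\<bar> + A)"

text \<open>Rays are total functions on \<open>real\<close> of which only the restriction to \<open>{0..}\<close> matters:
  all notions below are insensitive to values at negative arguments, and the equivalence
  classes forming the boundary are saturated under changing these values.\<close>

definition ray_image :: "(real \<Rightarrow> 'a) \<Rightarrow> 'a set" where
  "ray_image \<gamma> = \<gamma> ` {0..}"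

text \<open>Likewise, functions on \<open>[0,\<infinity>)\<close> are functions on \<open>real\<close> considered on \<open>{0..}\<close> only.\<close>

definition sublinear :: "(real \<Rightarrow> real) \<Rightarrow> bool" where
  "sublinear \<rho> \<longleftrightarrow> mono_on {0..} \<rho> \<and> (\<forall>\<^sub>F r in at_top. 0 \<le> \<rho> r) \<and>
     ((\<lambda>r. \<rho> r / r) \<longlongrightarrow> 0) at_top"

definition closest_points :: "'a::metric_space set \<Rightarrow> 'a \<Rightarrow> 'a set" where
  "closest_points Z x = {z \<in> Z. dist x z = infdist x Z}"

text \<open>Contraction is a notion for closed sets only. Images of discontinuous quasi-geodesics need
  not be closed, and without closedness \<open>closest_points\<close> may be empty, so closedness is part
  of the definition. The sets whose \<open>diameter\<close> is taken are always bounded.\<close>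

definition contracting_with :: "(real \<Rightarrow> real) \<Rightarrow> 'a::metric_space set \<Rightarrow> bool" where
  "contracting_with \<rho> Z \<longleftrightarrow> closed Z \<and>
     (\<forall>x y. dist x y \<le> infdist x Z \<longrightarrow>
        diameter (closest_points Z x \<union> closest_points Z y) \<le> \<rho> (infdist x Z))"

definition contracting :: "'a::metric_space set \<Rightarrow> bool" where
  "contracting Z \<longleftrightarrow> (\<exists>\<rho>. sublinear \<rho> \<and> contracting_with \<rho> Z)"

definition contracting_rays :: "'a::metric_space \<Rightarrow> (real \<Rightarrow> 'a) set" where
  "contracting_rays bp = {\<gamma>. (\<exists>L\<ge>1. \<exists>A\<ge>0. quasi_geodesic_on L A {0..} \<gamma>) \<and> \<gamma> 0 = bp \<and>
     contracting (ray_image \<gamma>)}"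

text \<open>Only applied to nonempty sets (for which \<open>infdist\<close> is the true distance).\<close>

definition finite_hausdorff_distance :: "'a::metric_space set \<Rightarrow> 'a set \<Rightarrow> bool" where
  "finite_hausdorff_distance S T \<longleftrightarrow>
     (\<exists>C. (\<forall>x\<in>S. infdist x T \<le> C) \<and> (\<forall>y\<in>T. infdist y S \<le> C))"

definition asymptotic_rel ::
    "'a::metric_space \<Rightarrow> ((real \<Rightarrow> 'a) \<times> (real \<Rightarrow> 'a)) set" where
  "asymptotic_rel bp = {(\<gamma>, \<gamma>'). \<gamma> \<in> contracting_rays bp \<and> \<gamma>' \<in> contracting_rays bp \<and>
     finite_hausdorff_distance (ray_image \<gamma>) (ray_image \<gamma>')}"

lemma finite_hausdorff_distance_trans:
  assumes "finite_hausdorff_distance S T" "finite_hausdorff_distance T U" "T \<noteq> {}"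
  shows "finite_hausdorff_distance S U"
proof -
  have step: "infdist x W \<le> C + D + 1"
    if "infdist x T \<le> C" "\<forall>y\<in>T. infdist y W \<le> D" for x W and C D :: real
  proof -
    have "infdist x T < C + 1" using that by simp
    then have "(INF t\<in>T. dist x t) < C + 1" using assms(3) by (simp add: infdist_def)
    then obtain t where t: "t \<in> T" "dist x t < C + 1"
      using cInf_lessD[of "dist x ` T" "C + 1"] assms(3) by blast
    have "infdist x W \<le> infdist t W + dist x t" by (rule infdist_triangle)
    moreover have "infdist t W \<le> D" using t that by blast
    ultimately show ?thesis using t by linarith
  qed
  from assms(1) obtain C where C: "\<forall>x\<in>S. infdist x T \<le> C" "\<forall>y\<in>T. infdist y S \<le> C"
    by (auto simp: finite_hausdorff_distance_def)
  from assms(2) obtain D where D: "\<forall>x\<in>T. infdist x U \<le> D" "\<forall>y\<in>U. infdist y T \<le> D"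
    by (auto simp: finite_hausdorff_distance_def)
  have "\<forall>x\<in>S. infdist x U \<le> C + D + 1" using step C(1) D(1) by blast
  moreover have "\<forall>x\<in>U. infdist x S \<le> C + D + 1"
    using step[of _ D S C] C(2) D(2) by (simp add: add.commute)
  ultimately show ?thesis unfolding finite_hausdorff_distance_def by blast
qed

lemma equiv_asymptotic_rel: "equiv (contracting_rays bp) (asymptotic_rel bp)"
proof (rule equivI)
  show "refl_on (contracting_rays bp) (asymptotic_rel bp)"
  proof (rule refl_onI)
    have "finite_hausdorff_distance S S" for S :: "'a set"
      unfolding finite_hausdorff_distance_def by (rule exI[of _ 0]) simp
    then show "(\<gamma>, \<gamma>) \<in> asymptotic_rel bp" if "\<gamma> \<in> contracting_rays bp" for \<gamma>
      using that by (simp add: asymptotic_rel_def)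
  qed
  show "sym (asymptotic_rel bp)"
    unfolding sym_def asymptotic_rel_def finite_hausdorff_distance_def by blast
  show "trans (asymptotic_rel bp)"
  proof (rule transI)
    fix \<alpha> \<beta> \<gamma> assume "(\<alpha>, \<beta>) \<in> asymptotic_rel bp" "(\<beta>, \<gamma>) \<in> asymptotic_rel bp"
    then show "(\<alpha>, \<gamma>) \<in> asymptotic_rel bp"
      using finite_hausdorff_distance_trans[of "ray_image \<alpha>" "ray_image \<beta>" "ray_image \<gamma>"]
      by (auto simp: asymptotic_rel_def ray_image_def)
  qed
qed (auto simp: asymptotic_rel_def)

definition contracting_boundary :: "'a::metric_space \<Rightarrow> (real \<Rightarrow> 'a) set set" where
  "contracting_boundary bp = contracting_rays bp // asymptotic_rel bp"

text \<open>For \<open>r \<ge> 0\<close> the supremum is over a nonempty bounded set of reals; negative \<open>r\<close> is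
  irrelevant. Members of \<open>\<zeta> \<in> contracting_boundary bp\<close> are based at \<open>bp\<close>.\<close>

definition rho_class :: "(real \<Rightarrow> 'a::metric_space) set \<Rightarrow> real \<Rightarrow> real" where
  "rho_class \<zeta> r = Sup {diameter (closest_points (ray_image \<alpha>) x \<union> closest_points (ray_image \<alpha>) y)
     | \<alpha> x y. \<alpha> \<in> \<zeta> \<and> geodesic_on {0..} \<alpha> \<and>
         dist x y \<le> infdist x (ray_image \<alpha>) \<and> infdist x (ray_image \<alpha>) \<le> r}"

definition kappa :: "(real \<Rightarrow> real) \<Rightarrow> real \<Rightarrow> real \<Rightarrow> real" where
  "kappa \<rho> L A =
     Max {3 * A, 3 * L\<^sup>2, 1 + Inf {R. R > 0 \<and> (\<forall>r\<ge>R. 3 * L\<^sup>2 * \<rho> r \<le> r)}}"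

text \<open>The argument \<open>\<alpha>\<close> is the choice \<open>\<zeta> \<mapsto> \<alpha>\<^sup>\<zeta>\<close> of a geodesic ray in each class.\<close>

definition geodesic_choice ::
    "'a::metric_space \<Rightarrow> ((real \<Rightarrow> 'a) set \<Rightarrow> (real \<Rightarrow> 'a)) \<Rightarrow> bool" where
  "geodesic_choice bp \<alpha> \<longleftrightarrow>
     (\<forall>\<zeta>\<in>contracting_boundary bp. \<alpha> \<zeta> \<in> \<zeta> \<and> geodesic_on {0..} (\<alpha> \<zeta>))"

definition FQ_nbhd :: "'a::metric_space \<Rightarrow> ((real \<Rightarrow> 'a) set \<Rightarrow> (real \<Rightarrow> 'a)) \<Rightarrow>
    (real \<Rightarrow> 'a) set \<Rightarrow> real \<Rightarrow> (real \<Rightarrow> 'a) set set" where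
  "FQ_nbhd bp \<alpha> \<zeta> r = {\<eta> \<in> contracting_boundary bp.
     \<forall>L\<ge>1. \<forall>A\<ge>0. \<forall>\<beta>\<in>\<eta>. quasi_geodesic_on L A {0..} \<beta> \<and> continuous_on {0..} \<beta> \<longrightarrow>
       setdist (ray_image \<beta>) {x \<in> ray_image (\<alpha> \<zeta>). dist x bp \<ge> r} \<le> kappa (rho_class \<zeta>) L A}"

definition FQ_open :: "'a::metric_space \<Rightarrow> ((real \<Rightarrow> 'a) set \<Rightarrow> (real \<Rightarrow> 'a)) \<Rightarrow>
    (real \<Rightarrow> 'a) set set \<Rightarrow> bool" where
  "FQ_open bp \<alpha> U \<longleftrightarrow>
     U \<subseteq> contracting_boundary bp \<and> (\<forall>\<zeta>\<in>U. \<exists>r\<ge>1. FQ_nbhd bp \<alpha> \<zeta> r \<subseteq> U)"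

definition FQ_topology :: "'a::metric_space \<Rightarrow> ((real \<Rightarrow> 'a) set \<Rightarrow> (real \<Rightarrow> 'a)) \<Rightarrow>
    (real \<Rightarrow> 'a) set topology" where
  "FQ_topology bp \<alpha> = topology (FQ_open bp \<alpha>)"

lemma contracting_boundary_based:
  assumes "\<zeta> \<in> contracting_boundary bp" "\<gamma> \<in> \<zeta>"
  shows "\<gamma> 0 = bp"
  using assms by (auto simp: contracting_boundary_def quotient_def asymptotic_rel_def
      contracting_rays_def)

lemma FQ_nbhd_antimono:
  assumes "geodesic_choice bp \<alpha>" "\<zeta> \<in> contracting_boundary bp" "r \<le> s"
  shows "FQ_nbhd bp \<alpha> \<zeta> s \<subseteq> FQ_nbhd bp \<alpha> \<zeta> r"
proof -
  let ?T = "\<lambda>r. {x \<in> ray_image (\<alpha> \<zeta>). dist x bp \<ge> r}"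
  have "\<alpha> \<zeta> 0 = bp" and g: "geodesic_on {0..} (\<alpha> \<zeta>)"
    using assms contracting_boundary_based by (auto simp: geodesic_choice_def)
  then have "dist (\<alpha> \<zeta> (max 0 s)) bp = max 0 s"
    unfolding geodesic_on_def by (metis abs_of_nonneg atLeast_iff diff_zero max.cobounded1 order_refl)
  then have "\<alpha> \<zeta> (max 0 s) \<in> ?T s" by (auto simp: ray_image_def)
  then have "setdist S (?T r) \<le> setdist S (?T s)" for S
    using assms(3) by (intro setdist_subset_right) auto
  then show ?thesis unfolding FQ_nbhd_def by (blast intro: order_trans)
qed

lemma istopology_FQ_open:
  assumes "geodesic_choice bp \<alpha>"
  shows "istopology (FQ_open bp \<alpha>)"
  unfolding istopology_def
proof (intro conjI allI impI)
  fix S T assume S: "FQ_open bp \<alpha> S" and T: "FQ_open bp \<alpha> T"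
  have "\<exists>r\<ge>1. FQ_nbhd bp \<alpha> \<zeta> r \<subseteq> S \<inter> T" if "\<zeta> \<in> S \<inter> T" for \<zeta>
  proof -
    have "\<exists>r\<ge>1. FQ_nbhd bp \<alpha> \<zeta> r \<subseteq> S" "\<exists>s\<ge>1. FQ_nbhd bp \<alpha> \<zeta> s \<subseteq> T"
      using S T that by (simp_all add: FQ_open_def)
    then obtain r s where "r \<ge> 1" "FQ_nbhd bp \<alpha> \<zeta> r \<subseteq> S" "FQ_nbhd bp \<alpha> \<zeta> s \<subseteq> T"
      by metis
    moreover have "\<zeta> \<in> contracting_boundary bp" using S that by (auto simp: FQ_open_def)
    ultimately have "max r s \<ge> 1 \<and> FQ_nbhd bp \<alpha> \<zeta> (max r s) \<subseteq> S \<inter> T"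
      using FQ_nbhd_antimono[OF assms, of \<zeta> r "max r s"]
        FQ_nbhd_antimono[OF assms, of \<zeta> s "max r s"] by fastforce
    then show ?thesis by blast
  qed
  then show "FQ_open bp \<alpha> (S \<inter> T)" using S by (auto simp: FQ_open_def)
next
  fix \<K> assume "\<forall>K\<in>\<K>. FQ_open bp \<alpha> K"
  then have sub: "\<And>K. K \<in> \<K> \<Longrightarrow> K \<subseteq> contracting_boundary bp"
    and nbhd: "\<And>K \<zeta>. K \<in> \<K> \<Longrightarrow> \<zeta> \<in> K \<Longrightarrow> \<exists>r\<ge>1. FQ_nbhd bp \<alpha> \<zeta> r \<subseteq> K"
    by (simp_all add: FQ_open_def)
  have "\<exists>r\<ge>1. FQ_nbhd bp \<alpha> \<zeta> r \<subseteq> \<Union>\<K>" if "K \<in> \<K>" "\<zeta> \<in> K" for K \<zeta>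
    using nbhd[OF that] that(1) by (meson Union_upper order_trans)
  then show "FQ_open bp \<alpha> (\<Union>\<K>)" using sub unfolding FQ_open_def by blast
qed

lemma openin_FQ_topology:
  assumes "geodesic_choice bp \<alpha>"
  shows "openin (FQ_topology bp \<alpha>) U \<longleftrightarrow> FQ_open bp \<alpha> U"
  unfolding FQ_topology_def by (simp add: istopology_FQ_open[OF assms] topology_inverse')

lemma topspace_FQ_topology:
  assumes "geodesic_choice bp \<alpha>"
  shows "topspace (FQ_topology bp \<alpha>) = contracting_boundary bp"
proof -
  have "FQ_open bp \<alpha> (contracting_boundary bp)"
    by (auto simp: FQ_open_def FQ_nbhd_def intro: exI[of _ 1])
  then show ?thesis
    unfolding topspace_def openin_FQ_topology[OF assms] by (auto simp: FQ_open_def)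
qed

end

theory Submission
  imports Defs
begin

text \<open>Every \<open>U(\<zeta>, r)\<close> contains the open set of all \<open>\<eta>\<close> with \<open>U(\<eta>, R') \<subseteq> U(\<zeta>, r)\<close> for some \<open>R'\<close>;
  these sets with \<open>r\<close> an integer form a countable neighbourhood base at \<open>\<zeta>\<close>. That they are open
  follows once each \<open>U(\<zeta>, r)\<close> is shown to have a smaller \<open>U(\<zeta>, R)\<close> such that every \<open>\<eta>\<close> in it
  satisfies \<open>U(\<eta>, R') \<subseteq> U(\<zeta>, r)\<close> for some \<open>R'\<close>. Let \<open>\<beta>\<close> be a quasi-geodesic ray in a class in
  \<open>U(\<eta>, R')\<close>. Very far out \<open>\<beta>\<close> comes close to \<open>\<alpha>\<^sup>\<eta>\<close>, and there it can be redirected towards \<open>\<eta>\<close> to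
  give a quasi-geodesic ray in \<open>\<eta>\<close> whose constants do not depend on \<open>\<eta>\<close>. As \<open>\<eta> \<in> U(\<zeta>, R)\<close>, this
  ray comes close to \<open>\<alpha>\<^sup>\<zeta>\<close> beyond \<open>R\<close>, so by contraction it stays close to \<open>\<alpha>\<^sup>\<zeta>\<close> before, where it
  still agrees with \<open>\<beta>\<close>. Finally an excursion of \<open>\<beta>\<close> away from the \<open>\<kappa>\<close>-neighbourhood of \<open>\<alpha>\<^sup>\<zeta>\<close>
  has length bounded in terms of the distances at its ends, so \<open>\<beta>\<close> is \<open>\<kappa>\<close>-close to \<open>\<alpha>\<^sup>\<zeta>\<close>
  beyond \<open>r\<close>.\<close>

section \<open>Quasi-geodesics far from a contracting set\<close>

lemma closest_points_nonempty:
  fixes Z :: "'a::metric_space set"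
  assumes "proper_space TYPE('a)" "closed Z" "Z \<noteq> {}"
  shows "closest_points Z x \<noteq> {}"
proof -
  obtain z where z: "z \<in> Z" using assms(3) by blast
  let ?K = "Z \<inter> cball x (dist x z)"
  have "compact ?K"
    using assms(1,2) by (auto simp: proper_space_def intro: closed_Int_compact)
  moreover have "?K \<noteq> {}" using z by auto
  moreover have "continuous_on ?K (dist x)" by (intro continuous_intros)
  ultimately obtain w where w: "w \<in> ?K" "\<forall>y\<in>?K. dist x w \<le> dist x y"
    using continuous_attains_inf[of ?K "dist x"] by blast
  have "dist x w \<le> dist x y" if "y \<in> Z" for y
  proof (cases "y \<in> cball x (dist x z)")
    case False
    then have "dist x w \<le> dist x z" "dist x z \<le> dist x y" using w(1) by auto
    then show ?thesis by linarith
  qed (use w(2) that in blast)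
  then have "dist x w \<le> infdist x Z"
    unfolding infdist_notempty[OF assms(3)] by (intro cINF_greatest) (use assms(3) in auto)
  moreover have "infdist x Z \<le> dist x w" using w(1) by (intro infdist_le) auto
  ultimately show ?thesis using w(1) by (auto simp: closest_points_def)
qed

lemma closest_pointsD:
  assumes "p \<in> closest_points Z x"
  shows "p \<in> Z" "dist x p = infdist x Z"
  using assms by (auto simp: closest_points_def)

lemma bounded_closest_points: "bounded (closest_points Z x)"
  by (rule bounded_subset[OF bounded_cball, of _ x "infdist x Z"]) (auto simp: closest_points_def)

lemma contracting_withD:
  assumes "contracting_with \<rho> Z" "dist x y \<le> infdist x Z"
    "p \<in> closest_points Z x \<union> closest_points Z y" "q \<in> closest_points Z x \<union> closest_points Z y"
  shows "dist p q \<le> \<rho> (infdist x Z)"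
proof -
  have "dist p q \<le> diameter (closest_points Z x \<union> closest_points Z y)"
    using assms(3,4) by (intro diameter_bounded_bound) (auto simp: bounded_closest_points)
  then show ?thesis using assms(1,2) by (fastforce simp: contracting_with_def)
qed

lemma contracting_with_closed: "contracting_with \<rho> Z \<Longrightarrow> closed Z"
  by (simp add: contracting_with_def)

section \<open>The threshold \<open>kappa\<close> and the basic quasi-geodesic estimates\<close>

lemma kappa_ge:
  shows "3 * A \<le> kappa \<rho> L A" "3 * L\<^sup>2 \<le> kappa \<rho> L A"
    and "1 + Inf {R. R > 0 \<and> (\<forall>r\<ge>R. 3 * L\<^sup>2 * \<rho> r \<le> r)} \<le> kappa \<rho> L A"
  by (auto simp: kappa_def)

text \<open>Sublinearity makes the set whose infimum enters \<open>kappa\<close> nonempty. The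
  infimum need not belong to the set; the added 1 puts \<open>r\<close> strictly above it, so some
  member of the set lies below \<open>r\<close>.\<close>

lemma sublinear_le_beyond_kappa:
  assumes "sublinear \<rho>" "L \<ge> 1" "r \<ge> kappa \<rho> L A"
  shows "3 * L\<^sup>2 * \<rho> r \<le> r"
proof -
  let ?S = "{R. R > 0 \<and> (\<forall>r\<ge>R. 3 * L\<^sup>2 * \<rho> r \<le> r)}"
  have L: "3 * L\<^sup>2 > 0" using assms(2) by auto
  have "((\<lambda>r. \<rho> r / r) \<longlongrightarrow> 0) at_top" using assms(1) by (simp add: sublinear_def)
  then have "\<forall>\<^sub>F r in at_top. \<rho> r / r < 1 / (3 * L\<^sup>2)"
    using L by (intro order_tendstoD) auto
  then obtain N where N: "\<And>r. r \<ge> N \<Longrightarrow> \<rho> r / r < 1 / (3 * L\<^sup>2)"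
    by (auto simp: eventually_at_top_linorder)
  have "3 * L\<^sup>2 * \<rho> r \<le> r" if "r \<ge> max N 1" for r
    using N[of r] that L by (simp add: field_simps)
  then have "max N 1 \<in> ?S" by auto
  then have ne: "?S \<noteq> {}" by blast
  have "Inf ?S < r" using kappa_ge(3)[where \<rho>=\<rho> and L=L and A=A] assms(3) by linarith
  then obtain R where "R \<in> ?S" "R < r" using cInf_lessD[OF ne] by blast
  then show ?thesis by auto
qed

lemma quasi_geodesic_on_subset:
  "quasi_geodesic_on L A I \<gamma> \<Longrightarrow> J \<subseteq> I \<Longrightarrow> is_interval J \<Longrightarrow> quasi_geodesic_on L A J \<gamma>"
  by (auto simp: quasi_geodesic_on_def)

lemma quasi_geodesic_on_mono:
  assumes "quasi_geodesic_on L A I \<gamma>" "1 \<le> L" "L \<le> L'" "A \<le> A'"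
  shows "quasi_geodesic_on L' A' I \<gamma>"
  unfolding quasi_geodesic_on_def
proof (intro conjI ballI)
  show "is_interval I" using assms(1) by (simp add: quasi_geodesic_on_def)
  fix s t assume "s \<in> I" "t \<in> I"
  then have *: "1 / L * \<bar>s - t\<bar> - A \<le> dist (\<gamma> s) (\<gamma> t)" "dist (\<gamma> s) (\<gamma> t) \<le> L * \<bar>s - t\<bar> + A"
    using assms(1) by (auto simp: quasi_geodesic_on_def)
  have "1 / L' * \<bar>s - t\<bar> \<le> 1 / L * \<bar>s - t\<bar>"
    using assms by (intro mult_right_mono divide_left_mono) auto
  then show "1 / L' * \<bar>s - t\<bar> - A' \<le> dist (\<gamma> s) (\<gamma> t)" using * assms(4) by linarith
  have "L * \<bar>s - t\<bar> \<le> L' * \<bar>s - t\<bar>" using assms by (intro mult_right_mono) auto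
  then show "dist (\<gamma> s) (\<gamma> t) \<le> L' * \<bar>s - t\<bar> + A'" using * assms(4) by linarith
qed

lemma quasi_geodesic_onD:
  assumes "quasi_geodesic_on L A I \<gamma>" "L \<ge> 1" "s \<in> I" "t \<in> I" "s \<le> t"
  shows "t - s \<le> L * (dist (\<gamma> s) (\<gamma> t) + A)" "dist (\<gamma> s) (\<gamma> t) \<le> L * (t - s) + A"
proof -
  have *: "1 / L * \<bar>s - t\<bar> - A \<le> dist (\<gamma> s) (\<gamma> t)" "dist (\<gamma> s) (\<gamma> t) \<le> L * \<bar>s - t\<bar> + A"
    using assms(1,3,4) unfolding quasi_geodesic_on_def by blast+
  show "t - s \<le> L * (dist (\<gamma> s) (\<gamma> t) + A)" using * assms by (simp add: field_simps)
  show "dist (\<gamma> s) (\<gamma> t) \<le> L * (t - s) + A" using * assms by simp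
qed

text \<open>Far from \<open>Z\<close> a path must travel a distance comparable to \<open>infdist _ Z\<close> before its projection
  can move by \<open>\<rho> (infdist _ Z)\<close>; the threshold \<open>kappa\<close> makes the projection slower than
  the path itself by a factor of two.\<close>

lemma projection_drift:
  fixes Z :: "'a::metric_space set"
  assumes proper: "proper_space TYPE('a)" and Z: "contracting_with \<rho> Z" "Z \<noteq> {}" and \<rho>: "sublinear \<rho>"
    and LA: "L \<ge> 1" "A \<ge> 0"
    and "quasi_geodesic_on L A {a..b} \<beta>" "continuous_on {a..b} \<beta>"
    and "\<And>t. t \<in> {a..b} \<Longrightarrow> kappa \<rho> L A \<le> infdist (\<beta> t) Z"
    and "a \<le> b" "p \<in> closest_points Z (\<beta> a)" and q: "q \<in> closest_points Z (\<beta> b)"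
  shows "dist p q \<le> (b - a + infdist (\<beta> b) Z / L) / (2 * L)"
proof -
  let ?d = "\<lambda>t. infdist (\<beta> t) Z"
  \<comment> \<open>Induction on an integer bound for the parameter length: the end \<open>b\<close>
    stays fixed, and each step either finishes or moves the start \<open>a\<close> forward by at
    least 1.\<close>
  have "dist p q \<le> (b - a + ?d b / L) / (2 * L)"
    if "b - a \<le> real n" "quasi_geodesic_on L A {a..b} \<beta>" "continuous_on {a..b} \<beta>"
      "\<And>t. t \<in> {a..b} \<Longrightarrow> kappa \<rho> L A \<le> ?d t" "a \<le> b" "p \<in> closest_points Z (\<beta> a)" for n a p
    using that
  proof (induction n arbitrary: a p)
    case (0 a p)
    have "a = b" using 0(1,5) by simp
    have da: "?d a \<ge> kappa \<rho> L A" using 0(5) by (intro 0(4)) simp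
    have "dist p q \<le> \<rho> (?d a)"
      using 0(6) q \<open>a = b\<close>
      by (intro contracting_withD[OF Z(1), of "\<beta> a" "\<beta> b"]) (simp_all add: infdist_nonneg)
    moreover have "3 * L\<^sup>2 * \<rho> (?d a) \<le> ?d a" by (rule sublinear_le_beyond_kappa[OF \<rho> LA(1) da])
    then have "\<rho> (?d a) \<le> ?d a / (3 * L\<^sup>2)" using LA by (simp add: field_simps)
    moreover have "?d a / (3 * L\<^sup>2) \<le> ?d a / (2 * L\<^sup>2)"
      using LA by (intro divide_left_mono) (auto simp: infdist_nonneg)
    ultimately show ?case using \<open>a = b\<close> by (simp add: power2_eq_square)
  next
    case (Suc n a p)
    have da: "?d a \<ge> kappa \<rho> L A" using Suc.prems(5) by (intro Suc.prems(4)) simp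
    have "3 * A \<le> ?d a" "3 * L\<^sup>2 \<le> ?d a"
      using kappa_ge(1)[where A=A and \<rho>=\<rho> and L=L] kappa_ge(2)[where A=A and \<rho>=\<rho> and L=L] da by auto
    have "3 * L\<^sup>2 * \<rho> (?d a) \<le> ?d a" by (rule sublinear_le_beyond_kappa[OF \<rho> LA(1) da])
    then have \<rho>d: "\<rho> (?d a) \<le> ?d a / (3 * L\<^sup>2)" using LA by (simp add: field_simps)
    show ?case
    proof (cases "dist (\<beta> a) (\<beta> b) \<le> ?d a")
      \<comment> \<open>One application of contraction suffices: \<open>A\<close> is at most a third
        of \<open>?d a\<close>, so two thirds of \<open>?d a\<close> are bounded by
        \<open>L * (b - a) + ?d b\<close>.\<close>
      case True
      have "dist p q \<le> \<rho> (?d a)"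
        using Suc.prems(6) q True by (intro contracting_withD[OF Z(1), of "\<beta> a" "\<beta> b"]) simp_all
      moreover have "?d a \<le> ?d b + dist (\<beta> a) (\<beta> b)" by (rule infdist_triangle)
      moreover have "dist (\<beta> a) (\<beta> b) \<le> L * (b - a) + A"
        using quasi_geodesic_onD(2)[OF Suc.prems(2) LA(1), of a b] Suc.prems(5) by simp
      ultimately have 1: "dist p q \<le> ?d a / (3 * L\<^sup>2)" and 2: "2 * ?d a / 3 \<le> L * (b - a) + ?d b"
        using \<rho>d \<open>3 * A \<le> ?d a\<close> by linarith+
      note 1
      also have "?d a / (3 * L\<^sup>2) = (2 * ?d a / 3) / (2 * L\<^sup>2)" by simp
      also have "\<dots> \<le> (L * (b - a) + ?d b) / (2 * L\<^sup>2)"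
        using 2 by (rule divide_right_mono) simp
      also have "\<dots> = (b - a + ?d b / L) / (2 * L)"
        using LA by (simp add: field_simps power2_eq_square)
      finally show ?thesis .
    next
      case False
      \<comment> \<open>Stop at distance exactly \<open>?d a\<close> from \<open>\<beta> a\<close>.
        Getting there takes time at least \<open>2 * ?d a / (3 * L)\<close> while the projection
        moves by at most \<open>?d a / (3 * L\<^sup>2)\<close>, which is the rate
        \<open>1 / (2 * L)\<close>.\<close>
      have "continuous_on {a..b} (\<lambda>t. dist (\<beta> a) (\<beta> t))"
        using Suc.prems(3) by (intro continuous_intros)
      then obtain c where c: "a \<le> c" "c \<le> b" "dist (\<beta> a) (\<beta> c) = ?d a"
        using IVT'[of "\<lambda>t. dist (\<beta> a) (\<beta> t)" a "?d a" b] False Suc.prems(5)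
        by (auto simp: infdist_nonneg)
      obtain p' where p': "p' \<in> closest_points Z (\<beta> c)"
        using closest_points_nonempty[OF proper contracting_with_closed[OF Z(1)] Z(2)] by blast
      have "dist (\<beta> a) (\<beta> c) \<le> L * (c - a) + A"
        using quasi_geodesic_onD(2)[OF Suc.prems(2) LA(1), of a c] c(1,2) by simp
      then have adv: "2 * ?d a / 3 \<le> L * (c - a)" using c(3) \<open>3 * A \<le> ?d a\<close> by linarith
      \<comment> \<open>The entry \<open>3 * L\<^sup>2\<close> of \<open>kappa\<close> makes the
        advance at least \<open>2 * L\<close>, so the integer bound drops by 1.\<close>
      then have "L * (2 * L) \<le> L * (c - a)"
        using \<open>3 * L\<^sup>2 \<le> ?d a\<close> by (simp add: power2_eq_square)
      then have "1 \<le> c - a" using LA by auto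
      have "dist p p' \<le> \<rho> (?d a)"
        using Suc.prems(6) p' c(3) by (intro contracting_withD[OF Z(1), of "\<beta> a" "\<beta> c"]) simp_all
      also have "\<dots> \<le> ?d a / (3 * L\<^sup>2)" by (rule \<rho>d)
      also have "\<dots> = (2 * ?d a / 3) / (2 * L\<^sup>2)" by simp
      also have "\<dots> \<le> (L * (c - a)) / (2 * L\<^sup>2)"
        using adv LA by (intro divide_right_mono) auto
      also have "\<dots> = (c - a) / (2 * L)" using LA by (simp add: power2_eq_square)
      finally have 1: "dist p p' \<le> (c - a) / (2 * L)" .
      have 2: "dist p' q \<le> (b - c + ?d b / L) / (2 * L)"
      proof (rule Suc.IH)
        show "b - c \<le> real n" using \<open>1 \<le> c - a\<close> Suc.prems(1) by simp
        show "quasi_geodesic_on L A {c..b} \<beta>"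
          using c by (intro quasi_geodesic_on_subset[OF Suc.prems(2)]) (auto simp: is_interval_cc)
        show "continuous_on {c..b} \<beta>"
          using c by (intro continuous_on_subset[OF Suc.prems(3)]) auto
        show "\<And>t. t \<in> {c..b} \<Longrightarrow> kappa \<rho> L A \<le> ?d t" using Suc.prems(4) c by auto
      qed (use c p' in auto)
      have "dist p q \<le> (c - a) / (2 * L) + (b - c + ?d b / L) / (2 * L)"
        using dist_triangle[of p q p'] 1 2 by linarith
      also have "\<dots> = (b - a + ?d b / L) / (2 * L)" by (simp add: add_divide_distrib diff_divide_distrib)
      finally show ?thesis .
    qed
  qed
  moreover obtain n :: nat where "b - a \<le> real n" using real_arch_simple by blast
  ultimately show ?thesis using assms(7-11) by blast
qed

text \<open>A detour through the nearest points bounds \<open>dist (\<beta> a) (\<beta> b)\<close>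
  by the two end distances plus the drift of the projection. The quasi-geodesic inequality
  multiplies this by \<open>L\<close>, so the drift contributes only half of \<open>b - a\<close>
  and is absorbed on the left.\<close>

lemma excursion_length:
  fixes Z :: "'a::metric_space set"
  assumes proper: "proper_space TYPE('a)" and Z: "contracting_with \<rho> Z" "Z \<noteq> {}" and \<rho>: "sublinear \<rho>"
    and LA: "L \<ge> 1" "A \<ge> 0"
    and qg: "quasi_geodesic_on L A {a..b} \<beta>" "continuous_on {a..b} \<beta>"
    and far: "\<And>t. t \<in> {a..b} \<Longrightarrow> kappa \<rho> L A \<le> infdist (\<beta> t) Z"
    and "a \<le> b"
  shows "b - a \<le> 2 * L * (infdist (\<beta> a) Z + 2 * infdist (\<beta> b) Z + A)"
proof -
  let ?d = "\<lambda>t. infdist (\<beta> t) Z"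
  obtain p q where p: "p \<in> closest_points Z (\<beta> a)" and q: "q \<in> closest_points Z (\<beta> b)"
    using closest_points_nonempty[OF proper contracting_with_closed[OF Z(1)] Z(2)] by blast
  have "dist (\<beta> a) (\<beta> b) \<le> dist (\<beta> a) p + dist p q + dist (\<beta> b) q"
    using dist_triangle[of "\<beta> a" "\<beta> b" p] dist_triangle[of p "\<beta> b" q] by (simp add: dist_commute)
  also have "\<dots> \<le> ?d a + (b - a + ?d b / L) / (2 * L) + ?d b"
    using projection_drift[OF assms p q] closest_pointsD[OF p] closest_pointsD[OF q] by simp
  finally have *: "dist (\<beta> a) (\<beta> b) \<le> ?d a + (b - a + ?d b / L) / (2 * L) + ?d b" .
  have "?d b / L \<le> ?d b / 1" using LA by (intro divide_left_mono) (auto simp: infdist_nonneg)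
  then have "(b - a + ?d b / L) / (2 * L) \<le> (b - a + ?d b) / (2 * L)"
    using LA by (intro divide_right_mono) auto
  also have "\<dots> = (b - a) / (2 * L) + ?d b / (2 * L)" by (simp add: add_divide_distrib)
  also have "?d b / (2 * L) \<le> ?d b / 1"
    using LA by (intro divide_left_mono) (auto simp: infdist_nonneg)
  finally have "dist (\<beta> a) (\<beta> b) + A \<le> ?d a + 2 * ?d b + A + (b - a) / (2 * L)" using * by simp
  moreover have "b - a \<le> L * (dist (\<beta> a) (\<beta> b) + A)"
    using quasi_geodesic_onD(1)[OF qg(1) LA(1)] \<open>a \<le> b\<close> by simp
  ultimately have "b - a \<le> L * (?d a + 2 * ?d b + A + (b - a) / (2 * L))"
    using LA by (meson mult_left_mono order_trans zero_le_one)
  also have "\<dots> = L * (?d a + 2 * ?d b + A) + (b - a) / 2"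
    using LA by (simp add: field_simps)
  finally have "b - a \<le> L * (?d a + 2 * ?d b + A) + (b - a) / 2" .
  moreover have "x \<le> 2 * X" if "x \<le> X + x / 2" for x X :: real using that by simp
  ultimately have "b - a \<le> 2 * (L * (?d a + 2 * ?d b + A))" by blast
  then show ?thesis by (simp only: mult.assoc)
qed

text \<open>Locates the start of an excursion above level \<open>k\<close>: the sublevel set is
  compact, and the intermediate value theorem gives equality at the exit time.\<close>

lemma last_time_near:
  fixes f :: "real \<Rightarrow> real"
  assumes cont: "continuous_on {a..b} f" and ab: "a \<le> b" "f a \<le> k"
  obtains c where "a \<le> c" "c \<le> b" "f c \<le> k" "\<And>t. c < t \<Longrightarrow> t \<le> b \<Longrightarrow> k < f t"
    "c < b \<Longrightarrow> f c = k"
proof -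
  let ?S = "{t\<in>{a..b}. f t \<le> k}"
  have "closed ?S" by (intro continuous_on_closed_Collect_le cont continuous_on_const closed_atLeastAtMost)
  then have "compact ({a..b} \<inter> ?S)" by (intro compact_Int_closed compact_Icc)
  moreover have "{a..b} \<inter> ?S = ?S" by blast
  ultimately have "compact ?S" by simp
  moreover have "a \<in> ?S" using ab by simp
  ultimately obtain c where c: "c \<in> ?S" "\<forall>t\<in>?S. t \<le> c" using compact_attains_sup[of ?S] by blast
  have gt: "k < f t" if "c < t" "t \<le> b" for t
  proof -
    have "t \<notin> ?S" using c(2) that(1) by force
    then show ?thesis using c(1) that by auto
  qed
  have fc: "f c = k" if cb: "c < b"
  proof (rule ccontr)
    assume "f c \<noteq> k"
    then have "f c < k" using c by simp
    moreover have "k < f b" using gt that by simp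
    moreover have "continuous_on {c..b} f" using c by (intro continuous_on_subset[OF cont]) auto
    ultimately obtain t where "c \<le> t" "t \<le> b" "f t = k"
      using IVT'[of f c k b] cb by auto
    then show False using gt[of t] \<open>f c < k\<close> by (cases "c = t") auto
  qed
  show ?thesis
  proof (rule that)
    show "a \<le> c" "c \<le> b" "f c \<le> k" using c(1) by auto
  qed (fact gt fc)+
qed

text \<open>The time reversal of \<open>last_time_near\<close>, for the end of an excursion.\<close>

lemma first_time_near:
  fixes f :: "real \<Rightarrow> real"
  assumes cont: "continuous_on {a..b} f" and ab: "a \<le> b" "f b \<le> k"
  obtains c where "a \<le> c" "c \<le> b" "f c \<le> k" "\<And>t. a \<le> t \<Longrightarrow> t < c \<Longrightarrow> k < f t"
    "a < c \<Longrightarrow> f c = k"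
proof -
  have "continuous_on {-b..-a} (\<lambda>t. f (- t))"
    by (rule continuous_on_compose2[OF cont]) (auto intro: continuous_intros)
  then obtain c where c: "-b \<le> c" "c \<le> -a" "f (-c) \<le> k"
    "\<And>t. c < t \<Longrightarrow> t \<le> -a \<Longrightarrow> k < f (-t)" "c < -a \<Longrightarrow> f (-c) = k"
    using last_time_near[of "-b" "-a" "\<lambda>t. f (- t)" k] ab by auto
  show ?thesis
  proof (rule that)
    show "a \<le> - c" "- c \<le> b" "f (- c) \<le> k" using c by auto
    show "k < f t" if "a \<le> t" "t < - c" for t using c(4)[of "- t"] that by simp
    show "f (- c) = k" if "a < - c" using c(5) that by simp
  qed
qed

text \<open>A time with distance above \<open>k\<close> lies in an excursion with both ends at
  distance exactly \<open>k\<close>. Such an excursion has parameter length at most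
  \<open>2 * L * (3 * k + A)\<close>, and the path cannot get farther away than this length
  allows.\<close>

lemma quasi_geodesic_stays_near:
  fixes Z :: "'a::metric_space set"
  assumes proper: "proper_space TYPE('a)" and Z: "contracting_with \<rho> Z" "Z \<noteq> {}" and \<rho>: "sublinear \<rho>"
    and LA: "L \<ge> 1" "A \<ge> 0"
    and qg: "quasi_geodesic_on L A {a..b} \<beta>" "continuous_on {a..b} \<beta>"
    and k: "kappa \<rho> L A \<le> k" and ends: "infdist (\<beta> a) Z \<le> k" "infdist (\<beta> b) Z \<le> k"
    and t: "t \<in> {a..b}"
  shows "infdist (\<beta> t) Z \<le> k + L * (2 * L * (3 * k + A)) + A"
proof -
  let ?d = "\<lambda>t. infdist (\<beta> t) Z"
  have k0: "0 \<le> k" using infdist_nonneg ends(1) by (rule order_trans)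
  then have E: "0 \<le> L * (2 * L * (3 * k + A)) + A" using LA by simp
  have cont: "continuous_on {a..b} ?d" using qg(2) by (intro continuous_intros)
  obtain c where c: "a \<le> c" "c \<le> t" "?d c \<le> k" "\<And>u. c < u \<Longrightarrow> u \<le> t \<Longrightarrow> k < ?d u" "c < t \<Longrightarrow> ?d c = k"
    using last_time_near[OF continuous_on_subset[OF cont, of "{a..t}"], of k] t ends by auto
  obtain e where e: "t \<le> e" "e \<le> b" "?d e \<le> k" "\<And>u. t \<le> u \<Longrightarrow> u < e \<Longrightarrow> k < ?d u" "t < e \<Longrightarrow> ?d e = k"
    using first_time_near[OF continuous_on_subset[OF cont, of "{t..b}"], of k] t ends by auto
  show ?thesis
  proof (cases "?d t \<le> k")
    case True
    then show ?thesis using E by linarith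
  next
    case False
    then have ct: "c < t" "t < e" using c e by (metis less_le)+
    have far: "kappa \<rho> L A \<le> ?d u" if "u \<in> {c..e}" for u
    proof -
      have "k \<le> ?d u"
        using that c(4)[of u] c(5) e(4)[of u] e(5) ct
        by (cases "u = c"; cases "u = e"; cases "u \<le> t") auto
      then show ?thesis using k by linarith
    qed
    have sub: "{c..e} \<subseteq> {a..b}" using c e by auto
    have "e - c \<le> 2 * L * (?d c + 2 * ?d e + A)"
      using ct far by (intro excursion_length[OF proper Z \<rho> LA quasi_geodesic_on_subset[OF qg(1) sub]
            continuous_on_subset[OF qg(2) sub]]) (auto simp: is_interval_cc)
    also have "\<dots> = 2 * L * (3 * k + A)" using c(5) e(5) ct by simp
    finally have "t - c \<le> 2 * L * (3 * k + A)" using ct by simp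
    then have "L * (t - c) \<le> L * (2 * L * (3 * k + A))" using LA by (intro mult_left_mono) auto
    moreover have "dist (\<beta> c) (\<beta> t) \<le> L * (t - c) + A"
      using c t by (intro quasi_geodesic_onD(2)[OF qg(1) LA(1)]) auto
    moreover have "?d t \<le> ?d c + dist (\<beta> c) (\<beta> t)" by (metis dist_commute infdist_triangle)
    ultimately show ?thesis using c(3) by linarith
  qed
qed

text \<open>A ray that never returned would contain arbitrarily long excursions with end distances
  at most \<open>C\<close>.\<close>

lemma quasi_geodesic_ray_returns:
  fixes Z :: "'a::metric_space set"
  assumes proper: "proper_space TYPE('a)" and Z: "contracting_with \<rho> Z" "Z \<noteq> {}" and \<rho>: "sublinear \<rho>"
    and LA: "L \<ge> 1" "A \<ge> 0"
    and qg: "quasi_geodesic_on L A {0..} \<beta>" "continuous_on {0..} \<beta>"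
    and bdd: "\<And>t. 0 \<le> t \<Longrightarrow> infdist (\<beta> t) Z \<le> C" and a: "0 \<le> a"
  shows "\<exists>t\<ge>a. infdist (\<beta> t) Z \<le> kappa \<rho> L A"
proof (rule ccontr)
  let ?d = "\<lambda>t. infdist (\<beta> t) Z"
  assume "\<not> ?thesis"
  then have far: "\<And>t. a \<le> t \<Longrightarrow> kappa \<rho> L A \<le> ?d t" by force
  \<comment> \<open>One more than the length that \<open>excursion_length\<close> allows when both
    end distances are at most \<open>C\<close>.\<close>
  define b where "b = a + 2 * L * (3 * C + A) + 1"
  have C: "0 \<le> C" using infdist_nonneg bdd[OF a] by (rule order_trans)
  then have "a \<le> b" using LA by (simp add: b_def)
  have sub: "{a..b} \<subseteq> {0..}" using a by auto
  have "b - a \<le> 2 * L * (?d a + 2 * ?d b + A)"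
    using far \<open>a \<le> b\<close> by (intro excursion_length[OF proper Z \<rho> LA quasi_geodesic_on_subset[OF qg(1) sub]
          continuous_on_subset[OF qg(2) sub]]) (auto simp: is_interval_cc)
  also have "\<dots> \<le> 2 * L * (3 * C + A)"
    using bdd[of a] bdd[of b] a \<open>a \<le> b\<close> LA by (intro mult_left_mono) auto
  finally show False by (simp add: b_def)
qed

section \<open>Stability of contraction under finite Hausdorff distance\<close>

lemma geodesic_spaceE:
  fixes x y :: "'a::metric_space"
  assumes "geodesic_space TYPE('a)" "0 \<le> r" "r \<le> dist x y"
  obtains w where "dist x w = r" "dist w y = dist x y - r"
proof -
  obtain \<gamma> where \<gamma>: "geodesic_on {0..dist x y} \<gamma>" "\<gamma> 0 = x" "\<gamma> (dist x y) = y"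
    using assms(1) by (auto simp: geodesic_space_def)
  have *: "dist (\<gamma> s) (\<gamma> t) = \<bar>s - t\<bar>" if "s \<in> {0..dist x y}" "t \<in> {0..dist x y}" for s t
    using \<gamma>(1) that by (simp add: geodesic_on_def)
  have "dist x (\<gamma> r) = r" using *[of 0 r] \<gamma>(2) assms(2,3) by simp
  moreover have "dist (\<gamma> r) y = dist x y - r" using *[of r "dist x y"] \<gamma>(3) assms(2,3) by simp
  ultimately show ?thesis by (rule that)
qed

lemma infdist_le_add_hausdorff:
  assumes "\<And>z. z \<in> S \<Longrightarrow> infdist z T \<le> C" "S \<noteq> {}"
  shows "infdist x T \<le> infdist x S + C"
proof (rule field_le_epsilon)
  fix e :: real assume "0 < e"
  then have "(INF z\<in>S. dist x z) < infdist x S + e" using assms(2) by (simp add: infdist_notempty)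
  then obtain z where z: "z \<in> S" "dist x z < infdist x S + e"
    using cInf_lessD[of "dist x ` S" "infdist x S + e"] assms(2) by blast
  have "infdist x T \<le> infdist z T + dist x z" by (rule infdist_triangle)
  then show "infdist x T \<le> infdist x S + C + e" using z assms(1)[of z] by linarith
qed

text \<open>A contraction function for closed sets \<open>C\<close>-close to a
  \<open>\<rho>\<close>-contracting set. If \<open>x\<close> has distance \<open>r\<close> to the
  new set and \<open>dist x y \<le> r\<close>, then \<open>x\<close> and \<open>y\<close> are within
  \<open>2 * r + C\<close> of the old one. The bracket generously bounds the distance from a fixed
  nearest point to any other, the factor 2 turns this into a diameter, and \<open>max 0\<close>
  covers arguments where \<open>\<rho>\<close> is negative.\<close>

definition hausdorff_transfer :: "(real \<Rightarrow> real) \<Rightarrow> real \<Rightarrow> real \<Rightarrow> real" where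
  "hausdorff_transfer \<rho> C r = 2 * (10 * C + 4 * max 0 (\<rho> (2 * r + C)))"

text \<open>The limit follows by writing \<open>\<rho> (2 * r + C) / r\<close> as the product of
  \<open>\<rho> (2 * r + C) / (2 * r + C)\<close>, which tends to 0, and \<open>2 + C / r\<close>,
  which stays bounded.\<close>

lemma sublinear_hausdorff_transfer:
  assumes "sublinear \<rho>" "0 \<le> C"
  shows "sublinear (hausdorff_transfer \<rho> C)"
  unfolding sublinear_def
proof (intro conjI)
  have mono: "mono_on {0..} \<rho>" and lim: "((\<lambda>r. \<rho> r / r) \<longlongrightarrow> 0) at_top"
    using assms(1) by (auto simp: sublinear_def)
  show "mono_on {0..} (hausdorff_transfer \<rho> C)"
  proof (rule mono_onI)
    fix r s :: real assume "r \<in> {0..}" "s \<in> {0..}" "r \<le> s"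
    then have "\<rho> (2 * r + C) \<le> \<rho> (2 * s + C)" using assms(2) by (intro mono_onD[OF mono]) auto
    then show "hausdorff_transfer \<rho> C r \<le> hausdorff_transfer \<rho> C s"
      by (auto simp: hausdorff_transfer_def)
  qed
  show "\<forall>\<^sub>F r in at_top. 0 \<le> hausdorff_transfer \<rho> C r"
    using assms(2) by (simp add: hausdorff_transfer_def)
  have "filterlim (\<lambda>r. C + 2 * r) at_top at_top"
    by (intro filterlim_tendsto_add_at_top[OF tendsto_const]
        filterlim_tendsto_pos_mult_at_top[OF tendsto_const] filterlim_ident) simp
  then have fl: "filterlim (\<lambda>r. 2 * r + C) at_top at_top" by (simp add: add.commute)
  have "((\<lambda>r. \<rho> (2 * r + C) / (2 * r + C)) \<longlongrightarrow> 0) at_top"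
    using filterlim_compose[OF lim fl] by simp
  then have "((\<lambda>r. max 0 (\<rho> (2 * r + C) / (2 * r + C))) \<longlongrightarrow> max 0 0) at_top"
    by (intro tendsto_max tendsto_const)
  moreover have "((\<lambda>r::real. C / r) \<longlongrightarrow> 0) at_top"
    by (intro real_tendsto_divide_at_top[OF tendsto_const] filterlim_ident)
  ultimately have "((\<lambda>r. 2 * (10 * (C / r) + 4 * (max 0 (\<rho> (2 * r + C) / (2 * r + C)) * (2 + C / r))))
      \<longlongrightarrow> 2 * (10 * 0 + 4 * (max 0 0 * (2 + 0)))) at_top"
    by (intro tendsto_mult tendsto_add tendsto_const)
  moreover have "\<forall>\<^sub>F r in at_top. 2 * (10 * (C / r) + 4 * (max 0 (\<rho> (2 * r + C) / (2 * r + C)) * (2 + C / r)))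
      = hausdorff_transfer \<rho> C r / r"
    using eventually_gt_at_top[of 0]
  proof eventually_elim
    case (elim r)
    have pos: "2 * r + C > 0" using elim assms(2) by simp
    have "max 0 (\<rho> (2 * r + C) / (2 * r + C)) = max 0 (\<rho> (2 * r + C)) / (2 * r + C)"
      using pos by (simp add: max_def zero_le_divide_iff)
    moreover have "2 + C / r = (2 * r + C) / r" using elim by (simp add: field_simps)
    ultimately have "max 0 (\<rho> (2 * r + C) / (2 * r + C)) * (2 + C / r) = max 0 (\<rho> (2 * r + C)) / r"
      using pos by simp
    then show ?case using elim by (simp add: hausdorff_transfer_def add_divide_distrib)
  qed
  ultimately show "((\<lambda>r. hausdorff_transfer \<rho> C r / r) \<longlongrightarrow> 0) at_top"
    by (simp add: tendsto_cong)
qed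

text \<open>Walk from \<open>x\<close> towards \<open>p'\<close> and stop at \<open>w\<close>, at
  distance \<open>C\<close> before \<open>p'\<close>. Then \<open>w\<close> is near enough to
  \<open>x\<close> for contraction of \<open>Z\<close> to apply, and it is within
  \<open>2 * C\<close> of its own nearest point in \<open>Z\<close>. If there is no room to stop,
  \<open>x\<close> itself is close to both sets.\<close>

lemma projection_hausdorff_close:
  fixes Z Z' :: "'a::metric_space set"
  assumes geo: "geodesic_space TYPE('a)" and proper: "proper_space TYPE('a)"
    and Z: "contracting_with \<rho> Z" "Z \<noteq> {}" and Z': "closed Z'" "Z' \<noteq> {}"
    and C: "\<And>z. z \<in> Z \<Longrightarrow> infdist z Z' \<le> C" "\<And>z. z \<in> Z' \<Longrightarrow> infdist z Z \<le> C"
    and p: "p \<in> closest_points Z x" and p': "p' \<in> closest_points Z' x"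
    and R: "\<And>s. 0 \<le> s \<Longrightarrow> s \<le> infdist x Z' + C \<Longrightarrow> \<rho> s \<le> R" "0 \<le> R"
  shows "dist p p' \<le> 3 * C + R"
proof -
  let ?r' = "infdist x Z'" and ?r = "infdist x Z"
  have p'Z: "p' \<in> Z'" "dist x p' = ?r'" using closest_pointsD[OF p'] by auto
  have pZ: "p \<in> Z" "dist x p = ?r" using closest_pointsD[OF p] by auto
  have rr: "?r \<le> ?r' + C" "?r' \<le> ?r + C"
    using infdist_le_add_hausdorff[OF C(2) Z'(2)] infdist_le_add_hausdorff[OF C(1) Z(2)] by auto
  have C0: "0 \<le> C" using infdist_nonneg C(1)[OF pZ(1)] by (rule order_trans)
  show ?thesis
  proof (cases "?r' \<le> C")
    case True
    have "dist p p' \<le> dist x p + dist x p'" by (metis dist_commute dist_triangle)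
    then show ?thesis using True pZ p'Z rr R(2) by linarith
  next
    case False
    obtain w where w: "dist x w = ?r' - C" "dist w p' = C"
      using geodesic_spaceE[OF geo, of "?r' - C" x p'] False p'Z C0 by auto
    obtain q where q: "q \<in> closest_points Z w"
      using closest_points_nonempty[OF proper contracting_with_closed[OF Z(1)] Z(2)] by blast
    have "dist p q \<le> \<rho> ?r"
      using p q w rr by (intro contracting_withD[OF Z(1), of x w]) auto
    also have "\<dots> \<le> R" using rr by (intro R) (auto simp: infdist_nonneg)
    finally have "dist p q \<le> R" .
    moreover have "infdist w Z \<le> infdist p' Z + dist w p'" by (rule infdist_triangle)
    then have "dist w q \<le> 2 * C" using C(2)[OF p'Z(1)] w closest_pointsD[OF q] by simp
    moreover have "dist p p' \<le> dist p q + dist w q + dist w p'"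
      using dist_triangle[of p p' q] dist_triangle[of q p' w] by (simp add: dist_commute)
    ultimately show ?thesis using w by linarith
  qed
qed

text \<open>Nearest points in \<open>Z'\<close> are compared with nearest points in \<open>Z\<close>
  by \<open>projection_hausdorff_close\<close>, which leaves the projections \<open>p\<close> and
  \<open>q\<close> of \<open>x\<close> and \<open>y\<close> to \<open>Z\<close> to be
  compared.\<close>

lemma contracting_with_hausdorff_transfer:
  fixes Z Z' :: "'a::metric_space set"
  assumes geo: "geodesic_space TYPE('a)" and proper: "proper_space TYPE('a)"
    and Z: "contracting_with \<rho> Z" "Z \<noteq> {}" and \<rho>: "sublinear \<rho>" and Z': "closed Z'" "Z' \<noteq> {}"
    and C: "\<And>z. z \<in> Z \<Longrightarrow> infdist z Z' \<le> C" "\<And>z. z \<in> Z' \<Longrightarrow> infdist z Z \<le> C"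
  shows "contracting_with (hausdorff_transfer \<rho> C) Z'"
  unfolding contracting_with_def
proof (intro conjI allI impI)
  show "closed Z'" by (rule Z')
  fix x y assume xy: "dist x y \<le> infdist x Z'"
  define r where "r = infdist x Z'"
  define R where "R = max 0 (\<rho> (2 * r + C))"
  have C0: "0 \<le> C" using Z(2) infdist_nonneg C(1) by (metis ex_in_conv order_trans)
  have r0: "0 \<le> r" by (simp add: r_def infdist_nonneg)
  have R: "\<rho> s \<le> R" if "0 \<le> s" "s \<le> 2 * r + C" for s
  proof -
    have "\<rho> s \<le> \<rho> (2 * r + C)"
      using \<rho> that unfolding sublinear_def by (auto elim!: mono_onD)
    then show ?thesis by (simp add: R_def)
  qed
  have R0: "0 \<le> R" by (simp add: R_def)
  note cpne = closest_points_nonempty[OF proper contracting_with_closed[OF Z(1)] Z(2)]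
  obtain p q where p: "p \<in> closest_points Z x" and q: "q \<in> closest_points Z y" using cpne by blast
  have y': "infdist y Z' \<le> 2 * r"
    using infdist_triangle[of y Z' x] xy by (simp add: r_def dist_commute)
  have rr: "infdist x Z \<le> r + C" "r \<le> infdist x Z + C" "infdist y Z \<le> 2 * r + C"
    using infdist_le_add_hausdorff[OF C(2) Z'(2), of x] infdist_le_add_hausdorff[OF C(1) Z(2), of x]
      infdist_le_add_hausdorff[OF C(2) Z'(2), of y] y' by (auto simp: r_def)
  have pp': "dist p p' \<le> 3 * C + R" if "p' \<in> closest_points Z' x" for p'
    using R r0 R0 by (intro projection_hausdorff_close[OF geo proper Z Z' C p that]) (auto simp: r_def)
  have qq': "dist q q' \<le> 3 * C + R" if "q' \<in> closest_points Z' y" for q'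
    using R R0 y' by (intro projection_hausdorff_close[OF geo proper Z Z' C q that]) auto
  have pq: "dist p q \<le> 4 * C + 2 * R"
  proof -
    \<comment> \<open>\<open>dist x y\<close> may exceed \<open>infdist x Z\<close> by up to
      \<open>C\<close>, so contraction at \<open>x\<close> is applied to a point \<open>w\<close> on
      the way to \<open>y\<close> instead. The remaining piece from \<open>w\<close> to
      \<open>y\<close> has length at most \<open>C\<close>.\<close>
    define t where "t = min (dist x y) (infdist x Z)"
    obtain w where w: "dist x w = t" "dist w y = dist x y - t"
      using geodesic_spaceE[OF geo, of t x y] by (auto simp: t_def infdist_nonneg)
    have wy: "dist w y \<le> C" using w xy rr C0 by (auto simp: t_def r_def min_def split: if_splits)
    obtain m where m: "m \<in> closest_points Z w" using cpne by blast
    have "dist p m \<le> \<rho> (infdist x Z)"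
      using p m w by (intro contracting_withD[OF Z(1), of x w]) (auto simp: t_def)
    also have "\<dots> \<le> R" using rr r0 by (intro R) (auto simp: infdist_nonneg)
    finally have pm: "dist p m \<le> R" .
    have mq: "dist m q \<le> 4 * C + R"
    proof (cases "infdist y Z \<le> C")
      \<comment> \<open>Both \<open>w\<close> and \<open>y\<close> are close to \<open>Z\<close>, so
        their nearest points are close for trivial reasons. In the other case contraction at
        \<open>y\<close> covers \<open>w\<close>.\<close>
      case True
      have "infdist w Z \<le> infdist y Z + dist w y" by (rule infdist_triangle)
      moreover have "dist m q \<le> dist w m + dist w y + dist y q"
        using dist_triangle[of m q w] dist_triangle[of w q y] by (simp add: dist_commute)
      ultimately show ?thesis
        using True wy closest_pointsD[OF m] closest_pointsD[OF q] R0 by linarith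
    next
      case False
      have "dist m q \<le> \<rho> (infdist y Z)"
        using q m wy False by (intro contracting_withD[OF Z(1), of y w]) (auto simp: dist_commute)
      also have "\<dots> \<le> R" using rr by (intro R) (auto simp: infdist_nonneg)
      finally show ?thesis using C0 by linarith
    qed
    show ?thesis using dist_triangle[of p q m] pm mq by linarith
  qed
  have "dist p u \<le> 10 * C + 4 * R" if "u \<in> closest_points Z' x \<union> closest_points Z' y" for u
    using that
  proof
    assume "u \<in> closest_points Z' x"
    then show ?thesis using pp'[of u] C0 R0 by linarith
  next
    assume "u \<in> closest_points Z' y"
    then show ?thesis using qq'[of u] pq dist_triangle[of p u q] C0 R0 by linarith
  qed
  then have "dist u v \<le> 2 * (10 * C + 4 * R)"
    if "u \<in> closest_points Z' x \<union> closest_points Z' y" "v \<in> closest_points Z' x \<union> closest_points Z' y" for u v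
    using that dist_triangle[of u v p] by (smt (verit, best) dist_commute)
  moreover have "hausdorff_transfer \<rho> C (infdist x Z') = 2 * (10 * C + 4 * R)"
    by (simp add: hausdorff_transfer_def R_def r_def)
  moreover have "closest_points Z' x \<union> closest_points Z' y \<noteq> {}"
    using closest_points_nonempty[OF proper Z'] by blast
  ultimately show "diameter (closest_points Z' x \<union> closest_points Z' y)
      \<le> hausdorff_transfer \<rho> C (infdist x Z')"
    unfolding diameter_def by (auto intro!: cSUP_least)
qed

section \<open>The contraction function of a boundary point\<close>

lemma geodesic_on_imp_quasi_geodesic_on: "geodesic_on I \<gamma> \<Longrightarrow> quasi_geodesic_on 1 0 I \<gamma>"
  by (auto simp: geodesic_on_def quasi_geodesic_on_def)

lemma geodesic_on_imp_continuous_on: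
  assumes "geodesic_on I \<gamma>"
  shows "continuous_on I \<gamma>"
  unfolding continuous_on_iff
proof (intro ballI allI impI)
  fix x and e :: real assume "x \<in> I" "0 < e"
  then show "\<exists>d>0. \<forall>y\<in>I. dist y x < d \<longrightarrow> dist (\<gamma> y) (\<gamma> x) < e"
    using assms by (intro exI[of _ e]) (auto simp: geodesic_on_def dist_real_def)
qed

lemma geodesic_ray_dist:
  "geodesic_on {0..} \<gamma> \<Longrightarrow> 0 \<le> s \<Longrightarrow> 0 \<le> t \<Longrightarrow> dist (\<gamma> s) (\<gamma> t) = \<bar>s - t\<bar>"
  by (simp add: geodesic_on_def)

lemma ray_image_nonempty [simp]: "ray_image \<gamma> \<noteq> {}"
  by (auto simp: ray_image_def)

lemma ray_image_I: "0 \<le> t \<Longrightarrow> \<gamma> t \<in> ray_image \<gamma>"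
  by (simp add: ray_image_def)

lemma ray_image_infdist_attained:
  fixes \<gamma> :: "real \<Rightarrow> 'a::metric_space"
  assumes "proper_space TYPE('a)" "closed (ray_image \<gamma>)"
  obtains t where "0 \<le> t" "dist x (\<gamma> t) = infdist x (ray_image \<gamma>)"
  using closest_points_nonempty[OF assms, of x] by (auto simp: closest_points_def ray_image_def)

text \<open>The ray returns after time \<open>t\<close>, so the bound for finite segments applies.
  The a priori bound \<open>C\<close> only ensures the return; it does not enter the
  conclusion.\<close>

lemma quasi_geodesic_ray_stays_near:
  fixes Z :: "'a::metric_space set"
  assumes proper: "proper_space TYPE('a)" and Z: "contracting_with \<rho> Z" "Z \<noteq> {}" and \<rho>: "sublinear \<rho>"
    and LA: "L \<ge> 1" "A \<ge> 0"
    and qg: "quasi_geodesic_on L A {0..} \<beta>" "continuous_on {0..} \<beta>"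
    and bdd: "\<And>t. 0 \<le> t \<Longrightarrow> infdist (\<beta> t) Z \<le> C"
    and k: "kappa \<rho> L A \<le> k" and start: "infdist (\<beta> 0) Z \<le> k" and t: "0 \<le> t"
  shows "infdist (\<beta> t) Z \<le> k + L * (2 * L * (3 * k + A)) + A"
proof -
  obtain b where b: "t \<le> b" "infdist (\<beta> b) Z \<le> kappa \<rho> L A"
    using quasi_geodesic_ray_returns[OF proper Z \<rho> LA qg bdd t] by blast
  have sub: "{0..b} \<subseteq> {0..}" by auto
  show ?thesis
    using b t k start
    by (intro quasi_geodesic_stays_near[OF proper Z \<rho> LA quasi_geodesic_on_subset[OF qg(1) sub]
          continuous_on_subset[OF qg(2) sub], of k]) (auto simp: is_interval_cc)
qed

text \<open>If \<open>\<alpha> u\<close> is nearest to \<open>\<gamma> t\<close>, then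
  \<open>u\<close> and \<open>t\<close> are the distances to the starting points, so they differ by
  at most \<open>K + dist (\<gamma> 0) (\<alpha> 0)\<close>.\<close>

lemma geodesic_rays_close:
  fixes \<alpha> \<gamma> :: "real \<Rightarrow> 'a::metric_space"
  assumes "proper_space TYPE('a)" "closed (ray_image \<alpha>)"
    and \<alpha>: "geodesic_on {0..} \<alpha>" and \<gamma>: "geodesic_on {0..} \<gamma>"
    and K: "infdist (\<gamma> t) (ray_image \<alpha>) \<le> K" and t: "0 \<le> t"
  shows "dist (\<gamma> t) (\<alpha> t) \<le> 2 * K + dist (\<gamma> 0) (\<alpha> 0)"
proof -
  obtain u where u: "0 \<le> u" "dist (\<gamma> t) (\<alpha> u) \<le> K"
    using ray_image_infdist_attained[OF assms(1,2), of "\<gamma> t"] K by metis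
  have "dist (\<gamma> t) (\<gamma> 0) = t" "dist (\<alpha> u) (\<alpha> 0) = u" "dist (\<alpha> u) (\<alpha> t) = \<bar>u - t\<bar>"
    using geodesic_ray_dist[OF \<alpha>] geodesic_ray_dist[OF \<gamma>] t u by auto
  moreover have "dist (\<gamma> t) (\<gamma> 0) \<le> dist (\<gamma> t) (\<alpha> u) + dist (\<alpha> u) (\<alpha> 0) + dist (\<gamma> 0) (\<alpha> 0)"
    using dist_triangle[of "\<gamma> t" "\<gamma> 0" "\<alpha> u"] dist_triangle[of "\<alpha> u" "\<gamma> 0" "\<alpha> 0"] by (simp add: dist_commute)
  moreover have "dist (\<alpha> u) (\<alpha> 0) \<le> dist (\<gamma> t) (\<alpha> u) + dist (\<gamma> t) (\<gamma> 0) + dist (\<gamma> 0) (\<alpha> 0)"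
    using dist_triangle[of "\<alpha> u" "\<alpha> 0" "\<gamma> t"] dist_triangle[of "\<gamma> t" "\<alpha> 0" "\<gamma> 0"] by (simp add: dist_commute)
  moreover have "dist (\<gamma> t) (\<alpha> t) \<le> dist (\<gamma> t) (\<alpha> u) + dist (\<alpha> u) (\<alpha> t)" by (rule dist_triangle)
  ultimately show ?thesis using u by linarith
qed

section \<open>Boundary points as equivalence classes of rays\<close>

lemma contracting_boundary_rays:
  "\<zeta> \<in> contracting_boundary bp \<Longrightarrow> \<gamma> \<in> \<zeta> \<Longrightarrow> \<gamma> \<in> contracting_rays bp"
  unfolding contracting_boundary_def using in_quotient_imp_subset[OF equiv_asymptotic_rel] by blast

lemma contracting_boundary_asymptotic:
  "\<zeta> \<in> contracting_boundary bp \<Longrightarrow> \<gamma> \<in> \<zeta> \<Longrightarrow> \<gamma>' \<in> \<zeta> \<Longrightarrow>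
     finite_hausdorff_distance (ray_image \<gamma>) (ray_image \<gamma>')"
  unfolding contracting_boundary_def
  using quotient_eq_iff[OF equiv_asymptotic_rel, of \<zeta> bp \<zeta> \<gamma> \<gamma>'] by (auto simp: asymptotic_rel_def)

lemma contracting_boundary_saturated:
  assumes "\<zeta> \<in> contracting_boundary bp" "\<gamma> \<in> \<zeta>" "\<gamma>' \<in> contracting_rays bp"
    "finite_hausdorff_distance (ray_image \<gamma>) (ray_image \<gamma>')"
  shows "\<gamma>' \<in> \<zeta>"
proof -
  have "(\<gamma>, \<gamma>') \<in> asymptotic_rel bp"
    using assms contracting_boundary_rays[OF assms(1,2)] by (simp add: asymptotic_rel_def)
  then show ?thesis
    using assms(1,2) in_quotient_imp_closed[OF equiv_asymptotic_rel] unfolding contracting_boundary_def by blast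
qed

lemma contracting_boundary_closed:
  "\<zeta> \<in> contracting_boundary bp \<Longrightarrow> \<gamma> \<in> \<zeta> \<Longrightarrow> closed (ray_image \<gamma>)"
  using contracting_boundary_rays[of \<zeta> bp \<gamma>]
  by (auto simp: contracting_rays_def contracting_def contracting_with_def)

text \<open>Two geodesic rays from the same point at finite Hausdorff distance are at a distance bounded
  in terms of the contraction function alone, so all geodesic rays in a class share one function.\<close>

lemma class_uniformly_contracting:
  fixes bp :: "'a::metric_space"
  assumes geo: "geodesic_space TYPE('a)" and proper: "proper_space TYPE('a)"
    and \<zeta>: "\<zeta> \<in> contracting_boundary bp" and \<alpha>: "\<alpha> \<in> \<zeta>" "geodesic_on {0..} \<alpha>"
  obtains \<rho> where "sublinear \<rho>"
    "\<And>\<gamma>. \<gamma> \<in> \<zeta> \<Longrightarrow> geodesic_on {0..} \<gamma> \<Longrightarrow> contracting_with \<rho> (ray_image \<gamma>)"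
proof -
  obtain \<rho> where \<rho>: "sublinear \<rho>" "contracting_with \<rho> (ray_image \<alpha>)"
    using contracting_boundary_rays[OF \<zeta> \<alpha>(1)] by (auto simp: contracting_rays_def contracting_def)
  define k where "k = kappa \<rho> 1 0"
  have k0: "0 \<le> k" using kappa_ge(1)[of 0 \<rho> 1] by (simp add: k_def)
  \<comment> \<open>With \<open>L = 1\<close> and \<open>A = 0\<close> the bound of
    \<open>quasi_geodesic_ray_stays_near\<close> is \<open>7 * k\<close>; comparing points at equal
    times on rays with a common start doubles it.\<close>
  have "contracting_with (hausdorff_transfer \<rho> (14 * k)) (ray_image \<gamma>)"
    if \<gamma>: "\<gamma> \<in> \<zeta>" "geodesic_on {0..} \<gamma>" for \<gamma>
  proof -
    have base: "\<gamma> 0 = bp" "\<alpha> 0 = bp" using contracting_boundary_based[OF \<zeta>] \<gamma> \<alpha> by auto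
    obtain C where C: "\<And>x. x \<in> ray_image \<gamma> \<Longrightarrow> infdist x (ray_image \<alpha>) \<le> C"
      using contracting_boundary_asymptotic[OF \<zeta> \<gamma>(1) \<alpha>(1)] by (auto simp: finite_hausdorff_distance_def)
    have "infdist (\<gamma> 0) (ray_image \<alpha>) \<le> k"
      using ray_image_I[of 0 \<alpha>] base k0 by simp
    then have "infdist (\<gamma> t) (ray_image \<alpha>) \<le> 7 * k" if "0 \<le> t" for t
      using quasi_geodesic_ray_stays_near[OF proper \<rho>(2) ray_image_nonempty \<rho>(1) order_refl order_refl
          geodesic_on_imp_quasi_geodesic_on[OF \<gamma>(2)] geodesic_on_imp_continuous_on[OF \<gamma>(2)], of C k t]
        C ray_image_I[of _ \<gamma>] that by (simp add: k_def)
    then have close: "dist (\<gamma> t) (\<alpha> t) \<le> 14 * k" if "0 \<le> t" for t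
      using geodesic_rays_close[OF proper contracting_with_closed[OF \<rho>(2)] \<alpha>(2) \<gamma>(2), of t "7 * k"] that base
      by simp
    show ?thesis
    proof (rule contracting_with_hausdorff_transfer[OF geo proper \<rho>(2) ray_image_nonempty \<rho>(1)
          contracting_boundary_closed[OF \<zeta> \<gamma>(1)] ray_image_nonempty])
      fix z assume "z \<in> ray_image \<alpha>"
      then obtain t where "0 \<le> t" "z = \<alpha> t" by (auto simp: ray_image_def)
      then show "infdist z (ray_image \<gamma>) \<le> 14 * k"
        using close[of t] ray_image_I[of t \<gamma>] by (intro infdist_le2) (auto simp: dist_commute)
    next
      fix z assume "z \<in> ray_image \<gamma>"
      then obtain t where "0 \<le> t" "z = \<gamma> t" by (auto simp: ray_image_def)
      then show "infdist z (ray_image \<alpha>) \<le> 14 * k"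
        using close[of t] ray_image_I[of t \<alpha>] by (intro infdist_le2) auto
    qed
  qed
  moreover have "sublinear (hausdorff_transfer \<rho> (14 * k))"
    using \<rho>(1) k0 by (intro sublinear_hausdorff_transfer) auto
  ultimately show ?thesis using that by blast
qed

text \<open>The common contraction function \<open>\<rho>\<close> of the class dominates the
  supremum. Hence the supremum is over a bounded set, and \<open>rho_class \<zeta>\<close> is
  squeezed between 0 and \<open>\<rho>\<close>.\<close>

lemma
  fixes bp :: "'a::metric_space"
  assumes geo: "geodesic_space TYPE('a)" and proper: "proper_space TYPE('a)"
    and \<zeta>: "\<zeta> \<in> contracting_boundary bp" and \<alpha>: "\<alpha> \<in> \<zeta>" "geodesic_on {0..} \<alpha>"
  shows sublinear_rho_class: "sublinear (rho_class \<zeta>)"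
    and contracting_with_rho_class: "contracting_with (rho_class \<zeta>) (ray_image \<alpha>)"
proof -
  obtain \<rho> where \<rho>: "sublinear \<rho>"
    "\<And>\<gamma>. \<gamma> \<in> \<zeta> \<Longrightarrow> geodesic_on {0..} \<gamma> \<Longrightarrow> contracting_with \<rho> (ray_image \<gamma>)"
    using class_uniformly_contracting[OF assms] by blast
  define S where "S r = {diameter (closest_points (ray_image \<alpha>) x \<union> closest_points (ray_image \<alpha>) y)
     | \<alpha> x y. \<alpha> \<in> \<zeta> \<and> geodesic_on {0..} \<alpha> \<and>
         dist x y \<le> infdist x (ray_image \<alpha>) \<and> infdist x (ray_image \<alpha>) \<le> r}" for r
  have rho: "rho_class \<zeta> r = Sup (S r)" for r by (simp add: rho_class_def S_def)
  have le: "v \<le> \<rho> r" if v: "v \<in> S r" for v r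
  proof -
    obtain \<gamma> x y where *: "v = diameter (closest_points (ray_image \<gamma>) x \<union> closest_points (ray_image \<gamma>) y)"
      "\<gamma> \<in> \<zeta>" "geodesic_on {0..} \<gamma>" "dist x y \<le> infdist x (ray_image \<gamma>)" "infdist x (ray_image \<gamma>) \<le> r"
      using v unfolding S_def by blast
    then have "v \<le> \<rho> (infdist x (ray_image \<gamma>))"
      using \<rho>(2)[OF *(2,3)] by (auto simp: contracting_with_def)
    also have "\<dots> \<le> \<rho> r"
      using \<rho>(1) *(5) infdist_nonneg[of x "ray_image \<gamma>"] unfolding sublinear_def by (auto elim!: mono_onD)
    finally show ?thesis .
  qed
  have bdd: "bdd_above (S r)" for r using le by (rule bdd_aboveI)
  have nonneg: "0 \<le> v" if "v \<in> S r" for v r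
    using that by (auto simp: S_def bounded_closest_points intro!: diameter_ge_0)
  \<comment> \<open>Witnessed by both points equal to \<open>\<alpha> 0\<close>, at distance 0 from
    the ray.\<close>
  have ne: "S r \<noteq> {}" if "0 \<le> r" for r
    using that \<alpha> ray_image_I[of 0 \<alpha>] unfolding S_def by (fastforce intro: exI[of _ "\<alpha> 0"])
  have bounds: "0 \<le> rho_class \<zeta> r" "rho_class \<zeta> r \<le> \<rho> r" if "0 \<le> r" for r
  proof -
    obtain v where "v \<in> S r" using ne \<open>0 \<le> r\<close> by blast
    then show "0 \<le> rho_class \<zeta> r" unfolding rho using nonneg by (intro cSup_upper2[OF _ _ bdd]) auto
    show "rho_class \<zeta> r \<le> \<rho> r" unfolding rho using ne \<open>0 \<le> r\<close> le by (intro cSup_least) auto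
  qed
  show "sublinear (rho_class \<zeta>)"
    unfolding sublinear_def
  proof (intro conjI)
    show "mono_on {0..} (rho_class \<zeta>)"
    proof (rule mono_onI)
      fix r s :: real assume "r \<in> {0..}" "s \<in> {0..}" "r \<le> s"
      then have "S r \<subseteq> S s" "S r \<noteq> {}" using ne[of r] unfolding S_def by fastforce+
      then show "rho_class \<zeta> r \<le> rho_class \<zeta> s" unfolding rho by (intro cSup_subset_mono bdd)
    qed
    show "\<forall>\<^sub>F r in at_top. 0 \<le> rho_class \<zeta> r"
      using eventually_ge_at_top[of 0] by eventually_elim (rule bounds)
    show "((\<lambda>r. rho_class \<zeta> r / r) \<longlongrightarrow> 0) at_top"
    proof (rule tendsto_sandwich[OF _ _ tendsto_const])
      show "\<forall>\<^sub>F r in at_top. 0 \<le> rho_class \<zeta> r / r"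
        using eventually_ge_at_top[of 0] by eventually_elim (simp add: bounds)
      show "\<forall>\<^sub>F r in at_top. rho_class \<zeta> r / r \<le> \<rho> r / r"
        using eventually_ge_at_top[of 0] by eventually_elim (simp add: bounds divide_right_mono)
      show "((\<lambda>r. \<rho> r / r) \<longlongrightarrow> 0) at_top" using \<rho>(1) by (simp add: sublinear_def)
    qed
  qed
  show "contracting_with (rho_class \<zeta>) (ray_image \<alpha>)"
    unfolding contracting_with_def
  proof (intro conjI allI impI)
    show "closed (ray_image \<alpha>)" by (rule contracting_boundary_closed[OF \<zeta> \<alpha>(1)])
    fix x y assume "dist x y \<le> infdist x (ray_image \<alpha>)"
    then show "diameter (closest_points (ray_image \<alpha>) x \<union> closest_points (ray_image \<alpha>) y)
        \<le> rho_class \<zeta> (infdist x (ray_image \<alpha>))"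
      unfolding rho using \<alpha> by (intro cSup_upper bdd) (auto simp: S_def)
  qed
qed

section \<open>Busemann rays and surgery\<close>

text \<open>Along a geodesic ray \<open>dist x (\<alpha> t) - t\<close> is nonincreasing in
  \<open>t\<close>, so the infimum is the usual limit as \<open>t\<close> tends to infinity.\<close>

definition busemann :: "(real \<Rightarrow> 'a::metric_space) \<Rightarrow> 'a \<Rightarrow> real" where
  "busemann \<alpha> x = (INF t\<in>{0..}. dist x (\<alpha> t) - t)"

lemma busemann_bounds:
  assumes "geodesic_on {0..} \<alpha>"
  shows "0 \<le> t \<Longrightarrow> busemann \<alpha> x \<le> dist x (\<alpha> t) - t" and "- dist x (\<alpha> 0) \<le> busemann \<alpha> x"
    and "bdd_below ((\<lambda>t. dist x (\<alpha> t) - t) ` {0..})"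
proof -
  have *: "- dist x (\<alpha> 0) \<le> dist x (\<alpha> t) - t" if "0 \<le> t" for t
    using geodesic_ray_dist[OF assms, of t 0] that dist_triangle[of "\<alpha> t" "\<alpha> 0" x]
    by (simp add: dist_commute)
  then show bdd: "bdd_below ((\<lambda>t. dist x (\<alpha> t) - t) ` {0..})"
    by (intro bdd_belowI2[where m="- dist x (\<alpha> 0)"]) auto
  show "busemann \<alpha> x \<le> dist x (\<alpha> t) - t" if "0 \<le> t"
    unfolding busemann_def using that by (intro cINF_lower[OF bdd]) auto
  show "- dist x (\<alpha> 0) \<le> busemann \<alpha> x"
    unfolding busemann_def using * by (intro cINF_greatest) auto
qed

lemma busemann_lipschitz:
  assumes "geodesic_on {0..} \<alpha>"
  shows "busemann \<alpha> x \<le> busemann \<alpha> y + dist x y"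
proof -
  have "busemann \<alpha> x - dist x y \<le> dist y (\<alpha> t) - t" if "0 \<le> t" for t
    using busemann_bounds(1)[OF assms that, of x] dist_triangle[of x "\<alpha> t" y] by linarith
  then have "busemann \<alpha> x - dist x y \<le> busemann \<alpha> y"
    unfolding busemann_def[of \<alpha> y] by (intro cINF_greatest) auto
  then show ?thesis by linarith
qed

text \<open>By monotonicity an almost optimal parameter may be replaced by any larger one.\<close>

lemma busemann_approx:
  assumes \<alpha>: "geodesic_on {0..} \<alpha>" and "0 < e"
  obtains t where "T \<le> t" "0 \<le> t" "dist x (\<alpha> t) - t < busemann \<alpha> x + e"
proof -
  have "(INF t\<in>{0..}. dist x (\<alpha> t) - t) < busemann \<alpha> x + e"
    using \<open>0 < e\<close> by (simp add: busemann_def)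
  then obtain n where n: "0 \<le> n" "dist x (\<alpha> n) - n < busemann \<alpha> x + e"
    using cINF_less_iff[OF _ busemann_bounds(3)[OF \<alpha>, of x]] by auto
  have "dist (\<alpha> n) (\<alpha> (max n T)) = max n T - n" using geodesic_ray_dist[OF \<alpha>, of n "max n T"] n by simp
  then have "dist x (\<alpha> (max n T)) - max n T < busemann \<alpha> x + e"
    using dist_triangle[of x "\<alpha> (max n T)" "\<alpha> n"] n by linarith
  then show ?thesis using n by (intro that[of "max n T"]) auto
qed

lemma continuous_on_busemann:
  assumes "geodesic_on {0..} \<alpha>"
  shows "continuous_on S (busemann \<alpha>)"
  unfolding continuous_on_iff
proof (intro ballI allI impI)
  fix x and e :: real assume "0 < e"
  have "\<bar>busemann \<alpha> y - busemann \<alpha> x\<bar> \<le> dist y x" for y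
    using busemann_lipschitz[OF assms, of x y] busemann_lipschitz[OF assms, of y x] by (auto simp: dist_commute)
  then show "\<exists>d>0. \<forall>y\<in>S. dist y x < d \<longrightarrow> dist (busemann \<alpha> y) (busemann \<alpha> x) < e"
    using \<open>0 < e\<close> by (intro exI[of _ e]) (auto simp: dist_real_def intro: le_less_trans)
qed

lemma compact_function_cballs:
  assumes "proper_space TYPE('a::metric_space)"
  shows "compact {f :: real \<Rightarrow> 'a. \<forall>t. f t \<in> cball p \<bar>t\<bar>}"
proof -
  have "compactin (product_topology (\<lambda>_. euclidean) UNIV) (PiE UNIV (\<lambda>t::real. cball p \<bar>t\<bar>))"
    using assms by (subst compactin_PiE) (auto simp: proper_space_def)
  moreover have "PiE UNIV (\<lambda>t::real. cball p \<bar>t\<bar>) = {f. \<forall>t. f t \<in> cball p \<bar>t\<bar>}"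
    by (auto simp: PiE_UNIV_domain)
  ultimately show ?thesis by (simp add: euclidean_product_topology)
qed

text \<open>The ray is a limit of geodesics from \<open>p\<close> to points far out on \<open>\<alpha>\<close>, obtained from Tychonoff
  compactness of a space of functions.\<close>

lemma busemann_ray:
  fixes \<alpha> :: "real \<Rightarrow> 'a::metric_space"
  assumes geo: "geodesic_space TYPE('a)" and proper: "proper_space TYPE('a)"
    and \<alpha>: "geodesic_on {0..} \<alpha>" and \<rho>: "contracting_with \<rho> (ray_image \<alpha>)" "sublinear \<rho>"
  obtains \<gamma> K where "geodesic_on {0..} \<gamma>" "\<gamma> 0 = p"
    "\<And>t. 0 \<le> t \<Longrightarrow> busemann \<alpha> (\<gamma> t) \<le> busemann \<alpha> p - t"
    "\<And>t. 0 \<le> t \<Longrightarrow> infdist (\<gamma> t) (ray_image \<alpha>) \<le> K"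
proof -
  define k where "k = max (kappa \<rho> 1 0) (infdist p (ray_image \<alpha>))"
  define P where "P = {f :: real \<Rightarrow> 'a. \<forall>t. f t \<in> cball p \<bar>t\<bar>}"
  \<comment> \<open>Closed conditions, decreasing in \<open>n\<close>, whose intersection describes
    the desired ray; the error \<open>1 / real (Suc n)\<close> is what a finite geodesic can
    achieve.\<close>
  define C where "C n = {f. \<forall>s t. 0 \<le> s \<and> s \<le> real n \<and> 0 \<le> t \<and> t \<le> real n \<longrightarrow>
      dist (f s) (f t) = \<bar>s - t\<bar> \<and> busemann \<alpha> (f t) \<le> busemann \<alpha> p - t + 1 / real (Suc n) \<and>
      infdist (f t) (ray_image \<alpha>) \<le> 7 * k}" for n
  have k0: "0 \<le> k" using infdist_nonneg[of p "ray_image \<alpha>"] by (simp add: k_def)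
  have "P \<inter> (\<Inter>n\<in>UNIV. C n) \<noteq> {}"
  proof (rule compact_imp_fip_image)
    show "compact P" unfolding P_def by (rule compact_function_cballs[OF proper])
    have coord: "continuous_on UNIV (\<lambda>f :: real \<Rightarrow> 'a. f t)" for t by (rule continuous_on_product_coordinates)
    show "closed (C n)" for n
      unfolding C_def
      by (intro closed_Collect_all closed_Collect_imp closed_Collect_conj closed_Collect_eq closed_Collect_le
          open_Collect_const continuous_intros coord continuous_on_compose2[OF continuous_on_busemann[OF \<alpha>] coord])
        auto
    fix I :: "nat set" assume "finite I"
    define m where "m = Max (insert 0 I)"
    have mono: "C m \<subseteq> C i" if "i \<in> I" for i
    proof -
      have "i \<le> m" using that \<open>finite I\<close> by (simp add: m_def)
      then have im: "real i \<le> real m" "1 / real (Suc m) \<le> 1 / real (Suc i)" by (simp_all add: field_simps)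
      show ?thesis
        unfolding C_def
      proof (intro subsetI CollectI allI impI, elim CollectE)
        fix f s t
        assume f: "\<forall>s t. 0 \<le> s \<and> s \<le> real m \<and> 0 \<le> t \<and> t \<le> real m \<longrightarrow>
            dist (f s) (f t) = \<bar>s - t\<bar> \<and> busemann \<alpha> (f t) \<le> busemann \<alpha> p - t + 1 / real (Suc m) \<and>
            infdist (f t) (ray_image \<alpha>) \<le> 7 * k"
          and st: "0 \<le> s \<and> s \<le> real i \<and> 0 \<le> t \<and> t \<le> real i"
        have "0 \<le> s \<and> s \<le> real m \<and> 0 \<le> t \<and> t \<le> real m" using st im(1) by linarith
        then have "dist (f s) (f t) = \<bar>s - t\<bar> \<and> busemann \<alpha> (f t) \<le> busemann \<alpha> p - t + 1 / real (Suc m) \<and>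
            infdist (f t) (ray_image \<alpha>) \<le> 7 * k" by (rule f[rule_format])
        then show "dist (f s) (f t) = \<bar>s - t\<bar> \<and> busemann \<alpha> (f t) \<le> busemann \<alpha> p - t + 1 / real (Suc i) \<and>
            infdist (f t) (ray_image \<alpha>) \<le> 7 * k" using im(2) by linarith
      qed
    qed
    \<comment> \<open>The lower bound on \<open>N\<close> makes the geodesic from \<open>p\<close>
      to \<open>\<alpha> N\<close> at least \<open>m\<close> long; the last condition makes its
      Busemann values almost optimal.\<close>
    obtain N where N: "real m + dist p (\<alpha> 0) \<le> N" "0 \<le> N"
      "dist p (\<alpha> N) - N < busemann \<alpha> p + 1 / real (Suc m)"
      using busemann_approx[OF \<alpha>, of "1 / real (Suc m)" "real m + dist p (\<alpha> 0)" p] by auto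
    define D where "D = dist p (\<alpha> N)"
    obtain c where c: "geodesic_on {0..D} c" "c 0 = p" "c D = \<alpha> N"
      using geo by (auto simp: geodesic_space_def D_def)
    have cd: "dist (c s) (c t) = \<bar>s - t\<bar>" if "s \<in> {0..D}" "t \<in> {0..D}" for s t
      using c(1) that by (simp add: geodesic_on_def)
    have mD: "real m \<le> D"
      using N geodesic_ray_dist[OF \<alpha>, of N 0] dist_triangle[of "\<alpha> N" "\<alpha> 0" p]
      by (simp add: D_def dist_commute)
    \<comment> \<open>Constant \<open>p\<close> elsewhere, so that \<open>f\<close> lies in the
      compact set \<open>P\<close> at all real arguments.\<close>
    define f where "f t = (if t \<in> {0..real m} then c t else p)" for t
    have "f \<in> P" using cd[of 0] c(2) mD by (auto simp: P_def f_def)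
    moreover have "f \<in> C m"
    proof -
      have "busemann \<alpha> (c t) \<le> busemann \<alpha> p - t + 1 / real (Suc m)" if t: "0 \<le> t" "t \<le> real m" for t
        using busemann_bounds(1)[OF \<alpha> N(2), of "c t"] cd[of t D] t mD c(3) N(3) by (simp add: D_def)
      moreover have "infdist (c t) (ray_image \<alpha>) \<le> 7 * k" if t: "0 \<le> t" "t \<le> real m" for t
      proof -
        have "infdist (c t) (ray_image \<alpha>) \<le> k + 1 * (2 * 1 * (3 * k + 0)) + 0"
          using t mD c k0 ray_image_I[OF N(2), of \<alpha>]
          by (intro quasi_geodesic_stays_near[OF proper \<rho>(1) ray_image_nonempty \<rho>(2) order_refl order_refl
              geodesic_on_imp_quasi_geodesic_on[OF c(1)] geodesic_on_imp_continuous_on[OF c(1)]])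
            (auto simp: k_def)
        then show ?thesis by simp
      qed
      ultimately show ?thesis using cd mD by (simp add: C_def f_def)
    qed
    ultimately show "P \<inter> (\<Inter>n\<in>I. C n) \<noteq> {}" using mono by blast
  qed
  then obtain \<gamma> where \<gamma>: "\<gamma> \<in> P" "\<And>n. \<gamma> \<in> C n" by blast
  show ?thesis
  proof
    show "\<gamma> 0 = p" using \<gamma>(1) unfolding P_def by (auto dest!: spec[of _ 0])
    show "geodesic_on {0..} \<gamma>"
      unfolding geodesic_on_def
    proof (intro conjI ballI)
      fix s t :: real assume "s \<in> {0..}" "t \<in> {0..}"
      moreover obtain n where "max s t \<le> real n" using real_arch_simple by blast
      ultimately show "dist (\<gamma> s) (\<gamma> t) = \<bar>s - t\<bar>" using \<gamma>(2)[of n] by (auto simp: C_def)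
    qed (simp add: is_interval_ci)
    fix t :: real assume t: "0 \<le> t"
    obtain n where n: "t \<le> real n" using real_arch_simple by blast
    then show "infdist (\<gamma> t) (ray_image \<alpha>) \<le> 7 * k" using \<gamma>(2)[of n] t by (auto simp: C_def)
    show "busemann \<alpha> (\<gamma> t) \<le> busemann \<alpha> p - t"
    proof (rule field_le_epsilon)
      fix e :: real assume "0 < e"
      then obtain m where m: "1 / real (Suc m) < e" using nat_approx_posE by blast
      have "1 / real (Suc (max n m)) \<le> 1 / real (Suc m)" by (simp add: field_simps)
      moreover have "busemann \<alpha> (\<gamma> t) \<le> busemann \<alpha> p - t + 1 / real (Suc (max n m))"
      proof -
        have "t \<le> real (max n m)" using n by linarith
        then show ?thesis using \<gamma>(2)[of "max n m"] t unfolding C_def by blast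
      qed
      ultimately show "busemann \<alpha> (\<gamma> t) \<le> busemann \<alpha> p - t + e" using m by linarith
    qed
  qed
qed

text \<open>By \<open>closest\<close>, a point \<open>\<gamma> t\<close> is at least as far from the
  initial part of \<open>\<beta>\<close> as from the junction \<open>\<beta> s\<close>. So the
  distance between points on the two pieces controls the distance of each to the junction, hence
  both parts of the parameter length. The additive constant is unchanged.\<close>

lemma quasi_geodesic_surgery:
  fixes \<beta> \<gamma> :: "real \<Rightarrow> 'a::metric_space"
  assumes LA: "L \<ge> 1" "A \<ge> 0" and \<beta>: "quasi_geodesic_on L A {0..} \<beta>" "continuous_on {0..} \<beta>"
    and \<gamma>: "geodesic_on {0..} \<gamma>" "\<gamma> 0 = \<beta> s" and s: "0 \<le> s"
    and closest: "\<And>t a. 0 \<le> t \<Longrightarrow> 0 \<le> a \<Longrightarrow> a \<le> s \<Longrightarrow> t \<le> dist (\<gamma> t) (\<beta> a)"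
  defines "\<beta>' \<equiv> \<lambda>u. if u \<le> s then \<beta> u else \<gamma> (u - s)"
  shows "quasi_geodesic_on (2 * L + 1) A {0..} \<beta>'" "continuous_on {0..} \<beta>'"
proof -
  let ?L = "2 * L + 1"
  have main: "1 / ?L * (v - u) - A \<le> dist (\<beta>' u) (\<beta>' v) \<and> dist (\<beta>' u) (\<beta>' v) \<le> ?L * (v - u) + A"
    if uv: "0 \<le> u" "u \<le> v" for u v
  proof -
    consider "v \<le> s" | "s < u" | "u \<le> s" "s < v" by linarith
    then show ?thesis
    proof cases
      case 1
      have "quasi_geodesic_on ?L A {0..} \<beta>" using LA by (intro quasi_geodesic_on_mono[OF \<beta>(1)]) auto
      then have "\<forall>x\<in>{0..}. \<forall>y\<in>{0..}. 1 / ?L * \<bar>x - y\<bar> - A \<le> dist (\<beta> x) (\<beta> y) \<and>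
          dist (\<beta> x) (\<beta> y) \<le> ?L * \<bar>x - y\<bar> + A" by (simp add: quasi_geodesic_on_def)
      from bspec[OF bspec[OF this, of u], of v] show ?thesis using 1 uv by (simp add: \<beta>'_def)
    next
      case 2
      have "dist (\<beta>' u) (\<beta>' v) = v - u"
        using geodesic_ray_dist[OF \<gamma>(1), of "u - s" "v - s"] 2 uv by (simp add: \<beta>'_def)
      moreover have "(v - u) / ?L \<le> (v - u) / 1" using uv LA by (intro divide_left_mono) auto
      moreover have "1 * (v - u) \<le> ?L * (v - u)" using uv LA by (intro mult_right_mono) auto
      ultimately show ?thesis using LA by simp
    next
      case 3
      define d where "d = dist (\<beta> u) (\<gamma> (v - s))"
      have d: "dist (\<beta>' u) (\<beta>' v) = d" using 3 by (simp add: \<beta>'_def d_def)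
      have vs: "dist (\<beta> s) (\<gamma> (v - s)) = v - s"
        using geodesic_ray_dist[OF \<gamma>(1), of 0 "v - s"] 3 \<gamma>(2) by simp
      have su: "s - u \<le> L * (dist (\<beta> u) (\<beta> s) + A)" "dist (\<beta> u) (\<beta> s) \<le> L * (s - u) + A"
        using quasi_geodesic_onD[OF \<beta>(1) LA(1), of u s] 3 uv by auto
      have "v - s \<le> d" using closest[of "v - s" u] 3 uv by (simp add: d_def dist_commute)
      have "dist (\<beta> u) (\<beta> s) \<le> d + (v - s)"
        using dist_triangle[of "\<beta> u" "\<beta> s" "\<gamma> (v - s)"] vs by (simp add: d_def dist_commute)
      then have "dist (\<beta> u) (\<beta> s) + A \<le> 2 * d + A" using \<open>v - s \<le> d\<close> by simp
      then have "L * (dist (\<beta> u) (\<beta> s) + A) \<le> L * (2 * d + A)" using LA by (intro mult_left_mono) auto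
      then have "v - u \<le> L * (2 * d + A) + d" using su(1) \<open>v - s \<le> d\<close> by linarith
      \<comment> \<open>The padding by \<open>(L + 1) * A\<close> allows \<open>2 * L + 1\<close> to
        be factored out.\<close>
      also have "\<dots> \<le> L * (2 * d + A) + d + (L + 1) * A" using LA by simp
      also have "\<dots> = ?L * (d + A)" by (simp add: algebra_simps)
      finally have "(v - u) / ?L \<le> d + A" using LA by (simp add: field_simps)
      moreover have "d \<le> ?L * (v - u) + A"
      proof -
        have "d \<le> L * (s - u) + A + (v - s)"
          using su(2) vs dist_triangle[of "\<beta> u" "\<gamma> (v - s)" "\<beta> s"] by (simp add: d_def)
        moreover have "L * (s - u) \<le> 2 * L * (v - u)" using 3 uv LA by (intro mult_mono) auto
        ultimately show ?thesis using 3 uv by (simp add: algebra_simps)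
      qed
      ultimately show ?thesis using d by simp
    qed
  qed
  show "quasi_geodesic_on ?L A {0..} \<beta>'"
    unfolding quasi_geodesic_on_def
  proof (intro conjI[OF is_interval_ci] ballI)
    fix u v :: real assume "u \<in> {0..}" "v \<in> {0..}"
    then show "1 / ?L * \<bar>u - v\<bar> - A \<le> dist (\<beta>' u) (\<beta>' v) \<and> dist (\<beta>' u) (\<beta>' v) \<le> ?L * \<bar>u - v\<bar> + A"
      using main[of u v] main[of v u] by (cases "u \<le> v") (auto simp: dist_commute abs_real_def)
  qed
  show "continuous_on {0..} \<beta>'"
    unfolding \<beta>'_def
  proof (rule continuous_on_cases_le)
    show "continuous_on {t \<in> {0..}. t \<le> s} \<beta>" by (rule continuous_on_subset[OF \<beta>(2)]) auto
    show "continuous_on {t \<in> {0..}. s \<le> t} (\<lambda>u. \<gamma> (u - s))"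
      by (rule continuous_on_compose2[OF geodesic_on_imp_continuous_on[OF \<gamma>(1)]])
        (auto intro: continuous_intros)
    show "continuous_on {0..} (\<lambda>u::real. u)" by (rule continuous_on_id)
  qed (use \<gamma>(2) in auto)
qed

text \<open>A convergent sequence is bounded, so the lower quasi-geodesic bound confines its
  parameters to a compact interval, whose image is closed.\<close>

lemma closed_quasi_geodesic_ray:
  fixes \<beta> :: "real \<Rightarrow> 'a::metric_space"
  assumes "L \<ge> 1" and \<beta>: "quasi_geodesic_on L A {0..} \<beta>" "continuous_on {0..} \<beta>"
  shows "closed (ray_image \<beta>)"
  unfolding closed_sequential_limits
proof (intro allI impI)
  fix x l assume x: "(\<forall>n. x n \<in> ray_image \<beta>) \<and> x \<longlonglongrightarrow> l"
  then have "bounded (range x)" by (intro convergent_imp_bounded) auto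
  then obtain e where e: "\<And>n. dist (\<beta> 0) (x n) \<le> e" unfolding bounded_any_center[of _ "\<beta> 0"] by auto
  have "x n \<in> \<beta> ` {0..L * (e + A)}" for n
  proof -
    obtain t where t: "0 \<le> t" "x n = \<beta> t" using x by (auto simp: ray_image_def)
    have "t \<le> L * (dist (\<beta> 0) (\<beta> t) + A)" using quasi_geodesic_onD(1)[OF \<beta>(1) assms(1), of 0 t] t by simp
    also have "\<dots> \<le> L * (e + A)" using e[of n] t assms(1) by (intro mult_left_mono) auto
    finally show ?thesis using t by auto
  qed
  moreover have "closed (\<beta> ` {0..L * (e + A)})"
    by (intro compact_imp_closed compact_continuous_image continuous_on_subset[OF \<beta>(2)] compact_Icc) auto
  ultimately have "l \<in> \<beta> ` {0..L * (e + A)}" using x unfolding closed_sequential_limits by blast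
  then show "l \<in> ray_image \<beta>" by (auto simp: ray_image_def)
qed

section \<open>Neighbourhoods in the topology of fellow-travelling quasi-geodesics\<close>

text \<open>Membership requires that \<open>\<beta>\<close> itself be contracting. Both images are
  at finite Hausdorff distance, so contraction transfers from \<open>\<alpha>\<close>; the initial
  segment of \<open>\<beta>\<close> adds \<open>L * s + A\<close> to the distance.\<close>

lemma fellow_traveller_in_class:
  fixes bp :: "'a::metric_space"
  assumes geo: "geodesic_space TYPE('a)" and proper: "proper_space TYPE('a)"
    and \<zeta>: "\<zeta> \<in> contracting_boundary bp" and \<alpha>: "\<alpha> \<in> \<zeta>"
    and LA: "L \<ge> 1" "A \<ge> 0" and \<beta>: "quasi_geodesic_on L A {0..} \<beta>" "continuous_on {0..} \<beta>" "\<beta> 0 = bp"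
    and s: "0 \<le> s" and close: "\<And>t. 0 \<le> t \<Longrightarrow> dist (\<beta> (s + t)) (\<alpha> t) \<le> D"
  shows "\<beta> \<in> \<zeta>"
proof -
  define C where "C = L * s + A + D"
  have "0 \<le> D" by (rule order_trans[OF zero_le_dist close[OF order_refl]])
  then have DC: "D \<le> C" using LA s by (simp add: C_def)
  have 1: "infdist x (ray_image \<beta>) \<le> C" if "x \<in> ray_image \<alpha>" for x
  proof -
    obtain t where t: "0 \<le> t" "x = \<alpha> t" using \<open>x \<in> ray_image \<alpha>\<close> by (auto simp: ray_image_def)
    then have "dist x (\<beta> (s + t)) \<le> C" using close[of t] DC by (simp add: dist_commute)
    then show ?thesis using s t by (intro infdist_le2[OF ray_image_I]) auto
  qed
  have 2: "infdist x (ray_image \<alpha>) \<le> C" if "x \<in> ray_image \<beta>" for x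
  proof -
    obtain u where u: "0 \<le> u" "x = \<beta> u" using \<open>x \<in> ray_image \<beta>\<close> by (auto simp: ray_image_def)
    show ?thesis
    proof (cases "s \<le> u")
      case True
      then have "dist x (\<alpha> (u - s)) \<le> C" using close[of "u - s"] u DC by simp
      then show ?thesis using True by (intro infdist_le2[OF ray_image_I]) auto
    next
      case False
      have "dist (\<beta> u) (\<beta> s) \<le> L * (s - u) + A"
        using False u by (intro quasi_geodesic_onD(2)[OF \<beta>(1) LA(1)]) auto
      also have "L * (s - u) \<le> L * s" using u LA by (intro mult_left_mono) auto
      finally have "dist x (\<alpha> 0) \<le> C"
        using close[of 0] u dist_triangle[of x "\<alpha> 0" "\<beta> s"] by (simp add: C_def)
      then show ?thesis by (intro infdist_le2[OF ray_image_I]) auto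
    qed
  qed
  obtain \<rho> where \<rho>: "sublinear \<rho>" "contracting_with \<rho> (ray_image \<alpha>)"
    using contracting_boundary_rays[OF \<zeta> \<alpha>] by (auto simp: contracting_rays_def contracting_def)
  have "contracting_with (hausdorff_transfer \<rho> C) (ray_image \<beta>)"
    by (intro contracting_with_hausdorff_transfer[OF geo proper \<rho>(2) _ \<rho>(1)] 1 2
        closed_quasi_geodesic_ray[OF LA(1) \<beta>(1,2)]) simp_all
  moreover have "sublinear (hausdorff_transfer \<rho> C)"
    using \<open>0 \<le> D\<close> DC by (intro sublinear_hausdorff_transfer \<rho>(1)) simp
  ultimately have "\<beta> \<in> contracting_rays bp"
    using LA \<beta> unfolding contracting_rays_def contracting_def by blast
  then show ?thesis
    using 1 2
    by (intro contracting_boundary_saturated[OF \<zeta> \<alpha>]) (auto simp: finite_hausdorff_distance_def)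
qed

text \<open>Leave \<open>\<beta>\<close> at a minimum of the Busemann function of \<open>\<alpha>\<close> over \<open>{0..S}\<close> and continue along a
  Busemann ray: the minimum makes the departure point closest to every point of that ray, so the
  new constants depend only on \<open>L\<close> and \<open>A\<close>.\<close>

lemma redirect_into_class:
  fixes bp :: "'a::metric_space"
  assumes geo: "geodesic_space TYPE('a)" and proper: "proper_space TYPE('a)"
    and \<zeta>: "\<zeta> \<in> contracting_boundary bp" and \<alpha>: "\<alpha> \<in> \<zeta>" "geodesic_on {0..} \<alpha>"
    and LA: "L \<ge> 1" "A \<ge> 0" and \<beta>: "quasi_geodesic_on L A {0..} \<beta>" "continuous_on {0..} \<beta>" "\<beta> 0 = bp"
    and S: "0 \<le> S" "0 \<le> t" "dist (\<beta> S) (\<alpha> t) \<le> M"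
  obtains \<beta>' s where "\<beta>' \<in> \<zeta>" "quasi_geodesic_on (2 * L + 1) A {0..} \<beta>'" "continuous_on {0..} \<beta>'"
    "0 \<le> s" "\<And>u. u \<le> s \<Longrightarrow> \<beta>' u = \<beta> u" "t - M \<le> dist (\<beta> s) bp"
proof -
  obtain \<rho> where \<rho>: "sublinear \<rho>" "contracting_with \<rho> (ray_image \<alpha>)"
    using contracting_boundary_rays[OF \<zeta> \<alpha>(1)] by (auto simp: contracting_rays_def contracting_def)
  have base: "\<alpha> 0 = bp" using contracting_boundary_based[OF \<zeta> \<alpha>(1)] .
  have "continuous_on {0..S} (\<lambda>u. busemann \<alpha> (\<beta> u))"
    by (rule continuous_on_compose2[OF continuous_on_busemann[OF \<alpha>(2), of UNIV]
          continuous_on_subset[OF \<beta>(2)]]) auto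
  then obtain s where s: "0 \<le> s" "s \<le> S"
    and min: "\<And>u. 0 \<le> u \<Longrightarrow> u \<le> S \<Longrightarrow> busemann \<alpha> (\<beta> s) \<le> busemann \<alpha> (\<beta> u)"
    using continuous_attains_inf[of "{0..S}" "\<lambda>u. busemann \<alpha> (\<beta> u)"] S(1) by auto
  obtain \<gamma> K where \<gamma>: "geodesic_on {0..} \<gamma>" "\<gamma> 0 = \<beta> s"
    "\<And>t. 0 \<le> t \<Longrightarrow> busemann \<alpha> (\<gamma> t) \<le> busemann \<alpha> (\<beta> s) - t"
    "\<And>t. 0 \<le> t \<Longrightarrow> infdist (\<gamma> t) (ray_image \<alpha>) \<le> K"
    using busemann_ray[OF geo proper \<alpha>(2) \<rho>(2,1), of "\<beta> s"] by blast
  define \<beta>' where "\<beta>' u = (if u \<le> s then \<beta> u else \<gamma> (u - s))" for u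
  \<comment> \<open>The Busemann function is 1-Lipschitz, is at least its value at
    \<open>\<beta> s\<close> on this part of \<open>\<beta>\<close>, and has dropped by
    \<open>t\<close> at \<open>\<gamma> t\<close>.\<close>
  have "t \<le> dist (\<gamma> t) (\<beta> a)" if "0 \<le> t" "0 \<le> a" "a \<le> s" for t a
    using \<gamma>(3)[OF that(1)] min[of a] that s busemann_lipschitz[OF \<alpha>(2), of "\<beta> a" "\<gamma> t"]
    by (simp add: dist_commute)
  then have qg: "quasi_geodesic_on (2 * L + 1) A {0..} \<beta>'" "continuous_on {0..} \<beta>'"
    unfolding \<beta>'_def using quasi_geodesic_surgery[OF LA \<beta>(1,2) \<gamma>(1,2) s(1)] by blast+
  have "\<beta>' (s + t) = \<gamma> t" if "0 \<le> t" for t using that \<gamma>(2) by (cases "t = 0") (auto simp: \<beta>'_def)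
  then have close: "dist (\<beta>' (s + t)) (\<alpha> t) \<le> 2 * K + dist (\<gamma> 0) (\<alpha> 0)" if "0 \<le> t" for t
    using that geodesic_rays_close[OF proper contracting_with_closed[OF \<rho>(2)] \<alpha>(2) \<gamma>(1,4)] by simp
  have "\<beta>' \<in> \<zeta>"
    by (rule fellow_traveller_in_class[OF geo proper \<zeta> \<alpha>(1) _ LA(2) qg _ s(1) close])
      (use LA s \<beta>(3) in \<open>simp_all add: \<beta>'_def\<close>)
  \<comment> \<open>The minimum is at most the value at \<open>\<beta> S\<close>, hence at most
    \<open>M - t\<close>, and is at least \<open>- dist (\<beta> s) bp\<close>.\<close>
  moreover have "t - M \<le> dist (\<beta> s) bp"
    using min[of S] S busemann_bounds(1)[OF \<alpha>(2) S(2), of "\<beta> S"] busemann_bounds(2)[OF \<alpha>(2), of "\<beta> s"] base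
    by simp
  ultimately show ?thesis using that[of \<beta>' s] qg s by (simp add: \<beta>'_def)
qed

text \<open>Makes later estimates uniform in \<open>L\<close> and \<open>A\<close>: rays with
  \<open>kappa\<close> at least \<open>r\<close> meet the neighbourhood condition trivially, and all
  others have constants at most \<open>r\<close>.\<close>

lemma kappa_less_imp:
  assumes "kappa \<rho> L A < r" "1 \<le> L"
  shows "3 * A \<le> r" "L \<le> r"
proof -
  show "3 * A \<le> r" using kappa_ge(1)[of A \<rho> L] assms(1) by linarith
  have "L * 1 \<le> L * L" using assms(2) by (intro mult_left_mono) auto
  moreover have "3 * (L * L) < r" using kappa_ge(2)[of L \<rho> A] assms(1) by (simp add: power2_eq_square)
  ultimately show "L \<le> r" using assms(2) by linarith
qed

text \<open>Go back from \<open>w\<close> to the last time \<open>a\<close> in the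
  \<open>kappa\<close>-neighbourhood. The excursion from \<open>a\<close> to \<open>w\<close> is too
  short to use up the distance of \<open>\<beta> w\<close> from the start, so
  \<open>\<beta> a\<close> is still \<open>2 * r\<close> away. The nearest point of
  \<open>\<alpha>\<close> is within \<open>kappa < r\<close> of it, hence beyond
  \<open>r\<close>.\<close>

lemma quasi_geodesic_last_contact:
  fixes \<alpha> \<beta> :: "real \<Rightarrow> 'a::metric_space"
  assumes proper: "proper_space TYPE('a)" and \<alpha>: "geodesic_on {0..} \<alpha>"
    and \<rho>: "contracting_with \<rho> (ray_image \<alpha>)" "sublinear \<rho>"
    and LA: "L \<ge> 1" "A \<ge> 0" and \<beta>: "quasi_geodesic_on L A {0..} \<beta>" "continuous_on {0..} \<beta>" "\<beta> 0 = \<alpha> 0"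
    and r: "kappa \<rho> L A < r" and w: "0 \<le> w" "infdist (\<beta> w) (ray_image \<alpha>) \<le> K"
      "r * (2 * r * (2 * r + 2 * K)) + 3 * r \<le> dist (\<beta> w) (\<alpha> 0)"
  obtains a v where "0 \<le> a" "0 \<le> v" "r \<le> v" "dist (\<beta> a) (\<alpha> v) \<le> kappa \<rho> L A"
proof -
  let ?d = "\<lambda>t. infdist (\<beta> t) (ray_image \<alpha>)" and ?k = "kappa \<rho> L A"
  have k0: "0 \<le> ?k" using kappa_ge(1)[of A \<rho> L] LA by linarith
  note Ar = kappa_less_imp(1)[OF r LA(1)] and Lr = kappa_less_imp(2)[OF r LA(1)]
  have K0: "0 \<le> K" using infdist_nonneg w(2) by (rule order_trans)
  have "continuous_on {0..w} ?d" by (intro continuous_intros continuous_on_subset[OF \<beta>(2)]) auto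
  moreover have "?d 0 \<le> ?k" using \<beta>(3) ray_image_I[of 0 \<alpha>] k0 by simp
  ultimately obtain a where a: "0 \<le> a" "a \<le> w" "?d a \<le> ?k" "\<And>t. a < t \<Longrightarrow> t \<le> w \<Longrightarrow> ?k < ?d t"
    "a < w \<Longrightarrow> ?d a = ?k"
    using last_time_near[of 0 w ?d ?k] w(1) by blast
  have "w - a \<le> 2 * r * (2 * r + 2 * K)"
  proof (cases "a < w")
    case True
    have far: "?k \<le> ?d t" if "t \<in> {a..w}" for t
      using a(4)[of t] a(5) True that by (cases "t = a") auto
    have sub: "{a..w} \<subseteq> {0..}" using a by auto
    have "w - a \<le> 2 * L * (?d a + 2 * ?d w + A)"
      using far a by (intro excursion_length[OF proper \<rho>(1) ray_image_nonempty \<rho>(2) LA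
            quasi_geodesic_on_subset[OF \<beta>(1) sub] continuous_on_subset[OF \<beta>(2) sub]])
        (auto simp: is_interval_cc)
    also have "\<dots> \<le> 2 * r * (2 * r + 2 * K)"
      using a(3) w(2) r Ar Lr LA K0 by (intro mult_mono) (auto simp: infdist_nonneg)
    finally show ?thesis .
  next
    case False
    then show ?thesis using a r k0 K0 by simp
  qed
  then have "L * (w - a) \<le> r * (2 * r * (2 * r + 2 * K))"
    using Lr a LA by (intro mult_mono) auto
  moreover have "dist (\<beta> a) (\<beta> w) \<le> L * (w - a) + A"
    using a by (intro quasi_geodesic_onD(2)[OF \<beta>(1) LA(1)]) auto
  moreover have "dist (\<beta> w) (\<alpha> 0) \<le> dist (\<beta> a) (\<beta> w) + dist (\<beta> a) (\<alpha> 0)"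
    by (metis dist_commute dist_triangle)
  ultimately have far: "2 * r \<le> dist (\<beta> a) (\<alpha> 0)" using w(3) Ar LA by linarith
  obtain v where v: "0 \<le> v" "dist (\<beta> a) (\<alpha> v) = ?d a"
    using ray_image_infdist_attained[OF proper contracting_with_closed[OF \<rho>(1)]] by blast
  have "dist (\<alpha> v) (\<alpha> 0) = v" using geodesic_ray_dist[OF \<alpha>, of v 0] v by simp
  then have "r \<le> v"
    using far a(3) v r dist_triangle[of "\<beta> a" "\<alpha> 0" "\<alpha> v"] by linarith
  then show ?thesis using that[of a v] a v by simp
qed

section \<open>Contact with the tails that define \<open>FQ_nbhd\<close>\<close>

lemma setdist_tail_le:
  assumes "geodesic_on {0..} \<alpha>" "\<alpha> 0 = bp" "0 \<le> a" "0 \<le> v" "r \<le> v" "dist (\<beta> a) (\<alpha> v) \<le> K"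
  shows "setdist (ray_image \<beta>) {x \<in> ray_image \<alpha>. dist x bp \<ge> r} \<le> K"
proof -
  have "dist (\<alpha> v) bp = v" using geodesic_ray_dist[OF assms(1), of v 0] assms by simp
  then have "setdist (ray_image \<beta>) {x \<in> ray_image \<alpha>. dist x bp \<ge> r} \<le> dist (\<beta> a) (\<alpha> v)"
    using assms by (intro setdist_le_dist) (auto intro: ray_image_I)
  then show ?thesis using assms(6) by linarith
qed

text \<open>The added 1 is paid because \<open>setdist\<close> is only an infimum.\<close>

lemma setdist_tailE:
  assumes "geodesic_on {0..} \<alpha>" "\<alpha> 0 = bp"
    "setdist (ray_image \<beta>) {x \<in> ray_image \<alpha>. dist x bp \<ge> r} \<le> K"
  obtains a v where "0 \<le> a" "0 \<le> v" "r \<le> v" "dist (\<beta> a) (\<alpha> v) \<le> K + 1"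
proof -
  let ?T = "{x \<in> ray_image \<alpha>. dist x bp \<ge> r}"
  have tail: "dist (\<alpha> v) bp = v" if "0 \<le> v" for v
    using geodesic_ray_dist[OF assms(1), of v 0] assms(2) that by simp
  have "\<alpha> (max 0 r) \<in> ?T" using tail[of "max 0 r"] by (auto intro: ray_image_I)
  then have ne: "?T \<noteq> {}" by (rule ex_in_conv[THEN iffD1, OF exI])
  have lt: "setdist (ray_image \<beta>) ?T < K + 1" using assms(3) by simp
  obtain x y where xy: "x \<in> ray_image \<beta>" "y \<in> ?T" "dist x y < K + 1"
    by (rule setdist_ltE[OF lt ray_image_nonempty ne])
  obtain a where "0 \<le> a" "x = \<beta> a" using xy(1) by (auto simp: ray_image_def)
  moreover obtain v where "0 \<le> v" "y = \<alpha> v" using xy(2) by (auto simp: ray_image_def)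
  ultimately show ?thesis using xy(2,3) tail[of v] by (intro that[of a v]) auto
qed

text \<open>A ray of the class returns to the \<open>kappa\<close>-neighbourhood at arbitrarily late
  times, when it is already far from the basepoint.\<close>

lemma FQ_nbhd_refl:
  fixes bp :: "'a::metric_space"
  assumes geo: "geodesic_space TYPE('a)" and proper: "proper_space TYPE('a)"
    and choice: "geodesic_choice bp \<alpha>" and \<zeta>: "\<zeta> \<in> contracting_boundary bp"
  shows "\<zeta> \<in> FQ_nbhd bp \<alpha> \<zeta> r"
  unfolding FQ_nbhd_def
proof (intro CollectI conjI[OF \<zeta>] allI ballI impI, elim conjE)
  fix L A \<beta> assume LA: "1 \<le> L" "0 \<le> A" and "\<beta> \<in> \<zeta>"
    and \<beta>: "quasi_geodesic_on L A {0..} \<beta>" "continuous_on {0..} \<beta>"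
  let ?\<rho> = "rho_class \<zeta>"
  let ?k = "kappa ?\<rho> L A" and ?Z = "ray_image (\<alpha> \<zeta>)"
  have \<alpha>: "\<alpha> \<zeta> \<in> \<zeta>" "geodesic_on {0..} (\<alpha> \<zeta>)" using choice \<zeta> by (auto simp: geodesic_choice_def)
  note \<rho> = contracting_with_rho_class[OF geo proper \<zeta> \<alpha>] sublinear_rho_class[OF geo proper \<zeta> \<alpha>]
  have base: "\<alpha> \<zeta> 0 = bp" "\<beta> 0 = bp" using contracting_boundary_based[OF \<zeta>] \<alpha>(1) \<open>\<beta> \<in> \<zeta>\<close> by auto
  obtain C where C: "\<And>x. x \<in> ray_image \<beta> \<Longrightarrow> infdist x ?Z \<le> C"
    using contracting_boundary_asymptotic[OF \<zeta> \<open>\<beta> \<in> \<zeta>\<close> \<alpha>(1)] by (auto simp: finite_hausdorff_distance_def)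
  \<comment> \<open>After this time the lower quasi-geodesic bound puts \<open>\<beta>\<close> at
    distance at least \<open>r + ?k\<close> from \<open>bp\<close>; \<open>max 0\<close> is there
    because \<open>r\<close> may be negative.\<close>
  define a where "a = max 0 (L * (r + ?k + A))"
  obtain t where t: "a \<le> t" "infdist (\<beta> t) ?Z \<le> ?k"
    using quasi_geodesic_ray_returns[OF proper \<rho>(1) ray_image_nonempty \<rho>(2) LA \<beta>, of C a] C ray_image_I[of _ \<beta>]
    by (auto simp: a_def)
  then have t0: "0 \<le> t" by (simp add: a_def)
  obtain v where v: "0 \<le> v" "dist (\<beta> t) (\<alpha> \<zeta> v) = infdist (\<beta> t) ?Z"
    using ray_image_infdist_attained[OF proper contracting_with_closed[OF \<rho>(1)]] by blast
  have "L * (r + ?k + A) \<le> t" using t(1) by (simp add: a_def)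
  also have "t \<le> L * (dist (\<beta> 0) (\<beta> t) + A)"
    using quasi_geodesic_onD(1)[OF \<beta>(1) LA(1), of 0 t] t0 by simp
  finally have "r + ?k \<le> dist (\<beta> 0) (\<beta> t)" using LA by simp
  moreover have "dist (\<alpha> \<zeta> 0) (\<alpha> \<zeta> v) = v" using geodesic_ray_dist[OF \<alpha>(2), of 0 v] v by simp
  ultimately have "r \<le> v"
    using t(2) v dist_triangle[of bp "\<beta> t" "\<alpha> \<zeta> v"] base by (simp add: dist_commute)
  then show "setdist (ray_image \<beta>) {x \<in> ?Z. dist x bp \<ge> r} \<le> ?k"
    using t t0 v by (intro setdist_tail_le[OF \<alpha>(2) base(1), of t v]) auto
qed

lemma FQ_nbhd_D:
  assumes "\<eta> \<in> FQ_nbhd bp \<alpha> \<zeta> r" "1 \<le> L" "0 \<le> A" "\<beta> \<in> \<eta>"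
    "quasi_geodesic_on L A {0..} \<beta>" "continuous_on {0..} \<beta>"
  shows "setdist (ray_image \<beta>) {x \<in> ray_image (\<alpha> \<zeta>). dist x bp \<ge> r} \<le> kappa (rho_class \<zeta>) L A"
  using assms by (auto simp: FQ_nbhd_def)

text \<open>\<open>R\<close> has to be chosen before \<open>\<eta>\<close>, so its ingredients
  depend only on \<open>\<zeta>\<close> and \<open>r\<close>; \<open>R'\<close> may depend on
  \<open>\<eta>\<close>.\<close>

lemma FQ_nbhd_interior:
  fixes bp :: "'a::metric_space"
  assumes geo: "geodesic_space TYPE('a)" and proper: "proper_space TYPE('a)"
    and choice: "geodesic_choice bp \<alpha>" and \<zeta>: "\<zeta> \<in> contracting_boundary bp" and r: "1 \<le> r"
  shows "\<exists>R\<ge>1. \<forall>\<eta>\<in>FQ_nbhd bp \<alpha> \<zeta> R. \<exists>R'\<ge>1. FQ_nbhd bp \<alpha> \<eta> R' \<subseteq> FQ_nbhd bp \<alpha> \<zeta> r"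
proof -
  have \<alpha>: "\<alpha> \<eta> \<in> \<eta>" "geodesic_on {0..} (\<alpha> \<eta>)" "\<alpha> \<eta> 0 = bp" if "\<eta> \<in> contracting_boundary bp" for \<eta>
    using choice that contracting_boundary_based[OF that] by (auto simp: geodesic_choice_def)
  note \<alpha>\<zeta> = \<alpha>[OF \<zeta>]
  let ?\<rho> = "rho_class \<zeta>"
  note \<rho> = contracting_with_rho_class[OF geo proper \<zeta> \<alpha>\<zeta>(1,2)] sublinear_rho_class[OF geo proper \<zeta> \<alpha>\<zeta>(1,2)]
  \<comment> \<open>\<open>L1\<close> and \<open>r\<close> bound the constants of a redirected ray,
    \<open>k\<close> its contact distance with \<open>\<alpha> \<zeta>\<close>, and \<open>K\<close>
    its distance from \<open>\<alpha> \<zeta>\<close> before contact. \<open>R0\<close> is the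
    distance from \<open>bp\<close> that \<open>quasi_geodesic_last_contact\<close> asks
    for.\<close>
  define L1 where "L1 = 2 * r + 1"
  define k where "k = kappa ?\<rho> L1 r + 1"
  define K where "K = k + L1 * (2 * L1 * (3 * k + r)) + r"
  define R0 where "R0 = r * (2 * r * (2 * r + 2 * K)) + 3 * r"
  have L1: "1 \<le> L1" using r by (simp add: L1_def)
  have k0: "0 \<le> k" using kappa_ge(1)[of r ?\<rho> L1] r by (simp add: k_def)
  then have K0: "0 \<le> K" using L1 r by (simp add: K_def)
  then have R0: "1 \<le> R0" using r by (simp add: R0_def add_increasing)
  have "\<exists>R'\<ge>1. FQ_nbhd bp \<alpha> \<eta> R' \<subseteq> FQ_nbhd bp \<alpha> \<zeta> r" if \<eta>: "\<eta> \<in> FQ_nbhd bp \<alpha> \<zeta> (R0 + k)" for \<eta>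
  proof -
    have \<eta>b: "\<eta> \<in> contracting_boundary bp" using \<eta> by (simp add: FQ_nbhd_def)
    \<comment> \<open>The contact distance of \<open>\<beta>\<close> with
      \<open>\<alpha> \<eta>\<close>, once its constants are known to be at most
      \<open>r\<close>.\<close>
    define M where "M = kappa (rho_class \<eta>) r r + 1"
    have M0: "0 \<le> M" using kappa_ge(1)[of r "rho_class \<eta>" r] r by (simp add: M_def)
    have "FQ_nbhd bp \<alpha> \<eta> (R0 + M) \<subseteq> FQ_nbhd bp \<alpha> \<zeta> r"
    proof
      fix \<eta>' assume \<eta>': "\<eta>' \<in> FQ_nbhd bp \<alpha> \<eta> (R0 + M)"
      have \<eta>'b: "\<eta>' \<in> contracting_boundary bp" using \<eta>' by (simp add: FQ_nbhd_def)
      show "\<eta>' \<in> FQ_nbhd bp \<alpha> \<zeta> r"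
        unfolding FQ_nbhd_def
      proof (intro CollectI conjI[OF \<eta>'b] allI ballI impI, elim conjE)
        fix L A \<beta> assume LA: "1 \<le> L" "0 \<le> A" and "\<beta> \<in> \<eta>'"
          and \<beta>: "quasi_geodesic_on L A {0..} \<beta>" "continuous_on {0..} \<beta>"
        have base: "\<beta> 0 = bp" using contracting_boundary_based[OF \<eta>'b \<open>\<beta> \<in> \<eta>'\<close>] .
        show "setdist (ray_image \<beta>) {x \<in> ray_image (\<alpha> \<zeta>). dist x bp \<ge> r} \<le> kappa ?\<rho> L A"
        proof (cases "kappa ?\<rho> L A < r")
          case False
          \<comment> \<open>Trivial case: the basepoint is already close enough to
            \<open>\<alpha> \<zeta> r\<close>.\<close>
          have "dist (\<beta> 0) (\<alpha> \<zeta> r) = r" using geodesic_ray_dist[OF \<alpha>\<zeta>(2), of 0 r] \<alpha>\<zeta>(3) base r by simp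
          then show ?thesis using False r by (intro setdist_tail_le[OF \<alpha>\<zeta>(2,3), of 0 r]) auto
        next
          case True
          have Ar: "A \<le> r" and Lr: "L \<le> r" using kappa_less_imp[OF True LA(1)] LA(2) by auto
          obtain S t where S: "0 \<le> S" "0 \<le> t" "R0 + M \<le> t" "dist (\<beta> S) (\<alpha> \<eta> t) \<le> M"
            using FQ_nbhd_D[OF \<eta>' r _ \<open>\<beta> \<in> \<eta>'\<close> quasi_geodesic_on_mono[OF \<beta>(1) LA(1) Lr Ar] \<beta>(2)] r
              setdist_tailE[OF \<alpha>(2,3)[OF \<eta>b], of \<beta> "R0 + M" "kappa (rho_class \<eta>) r r"]
            unfolding M_def by auto
          obtain \<beta>' s where \<beta>': "\<beta>' \<in> \<eta>" "quasi_geodesic_on (2 * L + 1) A {0..} \<beta>'" "continuous_on {0..} \<beta>'"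
            and s: "0 \<le> s" "\<And>u. u \<le> s \<Longrightarrow> \<beta>' u = \<beta> u" "t - M \<le> dist (\<beta> s) bp"
            using redirect_into_class[OF geo proper \<eta>b \<alpha>(1,2)[OF \<eta>b] LA \<beta> base S(1,2,4)] by blast
          have \<beta>'1: "quasi_geodesic_on L1 r {0..} \<beta>'"
            using LA Lr Ar by (intro quasi_geodesic_on_mono[OF \<beta>'(2)]) (auto simp: L1_def)
          obtain u v where u: "0 \<le> u" "0 \<le> v" "R0 + k \<le> v" "dist (\<beta>' u) (\<alpha> \<zeta> v) \<le> k"
            using FQ_nbhd_D[OF \<eta> L1 _ \<beta>'(1) \<beta>'1 \<beta>'(3)] r
              setdist_tailE[OF \<alpha>\<zeta>(2,3), of \<beta>' "R0 + k" "kappa ?\<rho> L1 r"]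
            unfolding k_def by auto
          have "dist (\<alpha> \<zeta> v) bp = v" using geodesic_ray_dist[OF \<alpha>\<zeta>(2), of v 0] \<alpha>\<zeta>(3) u by simp
          then have faru: "R0 \<le> dist (\<beta>' u) bp"
            using u dist_triangle[of "\<alpha> \<zeta> v" bp "\<beta>' u"] by (simp add: dist_commute)
          \<comment> \<open>Up to \<open>u\<close> the redirected ray is controlled by contact with
            \<open>\<alpha> \<zeta>\<close>, and up to \<open>s\<close> it agrees with
            \<open>\<beta>\<close>. Both endpoints are at distance at least \<open>R0\<close> from
            \<open>bp\<close>, so the usable part reaches that distance in either case.\<close>
          define m where "m = min u s"
          have m: "0 \<le> m" "m \<le> u" "m \<le> s" using u s by (auto simp: m_def)
          have "R0 \<le> dist (\<beta>' m) bp"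
            using faru s(2)[of s] s(3) S(3) by (auto simp: m_def min_def)
          moreover have "continuous_on {0..m} (\<lambda>u. dist (\<beta>' u) bp)"
            by (intro continuous_intros continuous_on_subset[OF \<beta>'(3)]) auto
          moreover have "dist (\<beta>' 0) bp \<le> R0" using s base R0 by simp
          ultimately obtain w where w: "0 \<le> w" "w \<le> m" "dist (\<beta>' w) bp = R0"
            using IVT'[of "\<lambda>u. dist (\<beta>' u) bp" 0 R0 m] m by auto
          have sub: "{0..u} \<subseteq> {0..}" by auto
          have "infdist (\<beta>' 0) (ray_image (\<alpha> \<zeta>)) \<le> k"
            using s base \<alpha>\<zeta>(3) ray_image_I[of 0 "\<alpha> \<zeta>"] k0 by simp
          moreover have "infdist (\<beta>' u) (ray_image (\<alpha> \<zeta>)) \<le> k"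
            using u by (intro infdist_le2[OF ray_image_I]) auto
          ultimately have "infdist (\<beta>' w) (ray_image (\<alpha> \<zeta>)) \<le> K"
            unfolding K_def using w m r L1
            by (intro quasi_geodesic_stays_near[OF proper \<rho>(1) ray_image_nonempty \<rho>(2) _ _
                  quasi_geodesic_on_subset[OF \<beta>'1 sub] continuous_on_subset[OF \<beta>'(3) sub]])
              (auto simp: is_interval_cc k_def)
          moreover have "\<beta>' w = \<beta> w" using w m by (intro s) simp
          ultimately obtain a v where "0 \<le> a" "0 \<le> v" "r \<le> v" "dist (\<beta> a) (\<alpha> \<zeta> v) \<le> kappa ?\<rho> L A"
            using quasi_geodesic_last_contact[OF proper \<alpha>\<zeta>(2) \<rho> LA \<beta>, of r w K] True w \<alpha>\<zeta>(3) base
            unfolding R0_def by auto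
          then show ?thesis by (intro setdist_tail_le[OF \<alpha>\<zeta>(2,3)])
        qed
      qed
    qed
    then show ?thesis using R0 M0 by (intro exI[of _ "R0 + M"]) auto
  qed
  then show ?thesis using R0 k0 by (intro exI[of _ "R0 + k"]) auto
qed

theorem corollary5p6:
  fixes bp :: "'a::metric_space"
    and \<alpha> :: "(real \<Rightarrow> 'a) set \<Rightarrow> (real \<Rightarrow> 'a)"
  assumes "proper_space TYPE('a)"
    and "geodesic_space TYPE('a)"
    and "geodesic_choice bp \<alpha>"
  shows "first_countable (FQ_topology bp \<alpha>)"
proof -
  let ?U = "FQ_nbhd bp \<alpha>"
  \<comment> \<open>The sets \<open>?U \<zeta> r\<close> are not known to be open, so the base
    consists of these interiors.\<close>
  define V where "V \<zeta> r = {\<eta> \<in> contracting_boundary bp. \<exists>R\<ge>1. ?U \<eta> R \<subseteq> ?U \<zeta> r}" for \<zeta> r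
  have VU: "V \<zeta> r \<subseteq> ?U \<zeta> r" for \<zeta> r
    using FQ_nbhd_refl[OF assms(2,1,3)] by (auto simp: V_def)
  have V_open: "FQ_open bp \<alpha> (V \<zeta> r)" for \<zeta> r
    unfolding FQ_open_def
  proof (intro conjI ballI)
    show "V \<zeta> r \<subseteq> contracting_boundary bp" by (auto simp: V_def)
    fix \<eta> assume "\<eta> \<in> V \<zeta> r"
    then obtain R where \<eta>: "\<eta> \<in> contracting_boundary bp" and R: "1 \<le> R" "?U \<eta> R \<subseteq> ?U \<zeta> r"
      by (auto simp: V_def)
    obtain R1 where R1: "1 \<le> R1" "\<forall>\<eta>'\<in>?U \<eta> R1. \<exists>R'\<ge>1. ?U \<eta>' R' \<subseteq> ?U \<eta> R"
      using FQ_nbhd_interior[OF assms(2,1,3) \<eta> R(1)] by blast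
    \<comment> \<open>Every point of \<open>?U \<eta> R1\<close> has a neighbourhood inside
      \<open>?U \<eta> R\<close>, hence inside \<open>?U \<zeta> r\<close>.\<close>
    have "?U \<eta> R1 \<subseteq> V \<zeta> r"
    proof
      fix \<eta>' assume "\<eta>' \<in> ?U \<eta> R1"
      moreover from this have "\<eta>' \<in> contracting_boundary bp" by (simp add: FQ_nbhd_def)
      ultimately show "\<eta>' \<in> V \<zeta> r" using R1 R(2) unfolding V_def by blast
    qed
    then show "\<exists>r'\<ge>1. ?U \<eta> r' \<subseteq> V \<zeta> r" using R1(1) by blast
  qed
  have "\<exists>\<B>. countable \<B> \<and> (\<forall>W\<in>\<B>. openin (FQ_topology bp \<alpha>) W) \<and>
      (\<forall>U. openin (FQ_topology bp \<alpha>) U \<and> \<zeta> \<in> U \<longrightarrow> (\<exists>W\<in>\<B>. \<zeta> \<in> W \<and> W \<subseteq> U))"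
    if \<zeta>: "\<zeta> \<in> contracting_boundary bp" for \<zeta>
  proof (intro exI conjI ballI allI impI)
    \<comment> \<open>\<open>Suc\<close> keeps the radius at least 1, so that it can itself serve as
      the \<open>R\<close> showing that \<open>\<zeta>\<close> lies in each of these sets.\<close>
    let ?\<B> = "range (\<lambda>n. V \<zeta> (real (Suc n)))"
    show "countable ?\<B>" by simp
    show "openin (FQ_topology bp \<alpha>) W" if "W \<in> ?\<B>" for W
      using that V_open by (auto simp: openin_FQ_topology[OF assms(3)])
    fix U assume "openin (FQ_topology bp \<alpha>) U \<and> \<zeta> \<in> U"
    then obtain r where "?U \<zeta> r \<subseteq> U" by (auto simp: openin_FQ_topology[OF assms(3)] FQ_open_def)
    moreover obtain n where "r \<le> real (Suc n)" by (meson lessI less_imp_le of_nat_less_iff order_trans real_arch_simple)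
    then have "?U \<zeta> (real (Suc n)) \<subseteq> ?U \<zeta> r" by (rule FQ_nbhd_antimono[OF assms(3) \<zeta>])
    moreover have "\<zeta> \<in> V \<zeta> (real (Suc n))"
      using \<zeta> by (auto simp: V_def intro!: exI[of _ "real (Suc n)"])
    ultimately show "\<exists>W\<in>?\<B>. \<zeta> \<in> W \<and> W \<subseteq> U" using VU by blast
  qed
  then show ?thesis
    unfolding first_countable_def topspace_FQ_topology[OF assms(3)] by blast
qed

end
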